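(* Let $\Gamma$ be a discrete group, $\Lambda\le\Gamma$ a subgroup, and $\Gamma\curvearrowright X$ an action by homeomorphisms on a compact Hausdorff space $X$. Then $\Gamma\curvearrowright X$ is a $\Gamma/\Lambda$-boundary if and only if $$\emptyset\neq\mathrm{Prob}_\Lambda(X)\subseteq\mathrm{Prob}^c(X).$$
   Context: $\lambda_{\Gamma/\Lambda}:\Gamma\to\mathcal{U}(\ell^2(\Gamma/\Lambda))$ is the quasi-regular representation $\lambda_{\Gamma/\Lambda}(g)\delta_{h\Lambda}=\delta_{gh\Lambda}$, and $\Gamma$ acts on $B(\ell^2(\Gamma/\Lambda))$ by $g\cdot x=\lambda_{\Gamma/\Lambda}(g)x\lambda_{\Gamma/\Lambda}(g^{-1})$. A $\Gamma$-map between operator systems carrying $\Gamma$-actions is a unital completely positive $\Gamma$-equivariant linear map. The action $\Gamma\curvearrowright X$ (or the space $X$) is called a $\Gamma/\Lambda$-boundary if there is a $\Gamma$-map $C(X)\to B(\ell^2(\Gamma/\Lambda))$ and every such $\Gamma$-map is isometric. $\mathrm{Prob}(X)$ is the set of Borel (Radon) probability measures on $X$. A measure $\nu\in\mathrm{Prob}(X)$ is contractible if $\delta_x\in\overline{\Gamma\nu}^{\,\text{weak*}}$ for every $x\in X$. $\mathrm{Prob}^c(X)$ denotes the set of contractible probability measures on $X$ and $\mathrm{Prob}_\Lambda(X)$ the set of $\Lambda$-invariant probability measures on $X$. *)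

theory Defs
  imports
    "HOL-Probability.Probability"
    "HOL-Algebra.Left_Coset"
    "HOL-Algebra.Group_Action"
begin

section \<open>Operator systems and equivariant ucp maps\<close>

text \<open>
  The data of an operator system that the notion of a (unital, completely positive, isometric)
  map refers to.  The set \<open>os_pos S n\<close> is the cone of positive elements of the matrix space
  \<open>M\<^sub>n(S)\<close>; a matrix is a function of two indices of which only the values at \<open>i, j < n\<close> matter.
\<close>

record 'a op_system =
  os_carrier :: "'a set"
  os_add :: "'a \<Rightarrow> 'a \<Rightarrow> 'a"
  os_scale :: "complex \<Rightarrow> 'a \<Rightarrow> 'a"
  os_unit :: "'a"
  os_pos :: "nat \<Rightarrow> (nat \<Rightarrow> nat \<Rightarrow> 'a) set"
  os_norm :: "'a \<Rightarrow> real"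

definition os_linear :: "'a op_system \<Rightarrow> 'b op_system \<Rightarrow> ('a \<Rightarrow> 'b) \<Rightarrow> bool" where
  "os_linear S T \<Phi> \<longleftrightarrow>
     (\<forall>x\<in>os_carrier S. \<Phi> x \<in> os_carrier T) \<and>
     (\<forall>x\<in>os_carrier S. \<forall>y\<in>os_carrier S. \<Phi> (os_add S x y) = os_add T (\<Phi> x) (\<Phi> y)) \<and>
     (\<forall>a. \<forall>x\<in>os_carrier S. \<Phi> (os_scale S a x) = os_scale T a (\<Phi> x))"

definition completely_positive :: "'a op_system \<Rightarrow> 'b op_system \<Rightarrow> ('a \<Rightarrow> 'b) \<Rightarrow> bool" where
  "completely_positive S T \<Phi> \<longleftrightarrow>
     (\<forall>n. \<forall>A\<in>os_pos S n. (\<lambda>i j. \<Phi> (A i j)) \<in> os_pos T n)"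

definition os_isometric :: "'a op_system \<Rightarrow> 'b op_system \<Rightarrow> ('a \<Rightarrow> 'b) \<Rightarrow> bool" where
  "os_isometric S T \<Phi> \<longleftrightarrow> (\<forall>x\<in>os_carrier S. os_norm T (\<Phi> x) = os_norm S x)"

definition equivariant_ucp_map ::
  "('g, 'm) monoid_scheme \<Rightarrow> 'a op_system \<Rightarrow> ('g \<Rightarrow> 'a \<Rightarrow> 'a) \<Rightarrow>
   'b op_system \<Rightarrow> ('g \<Rightarrow> 'b \<Rightarrow> 'b) \<Rightarrow> ('a \<Rightarrow> 'b) \<Rightarrow> bool" where
  "equivariant_ucp_map G S \<alpha> T \<beta> \<Phi> \<longleftrightarrow>
     os_linear S T \<Phi> \<and> \<Phi> (os_unit S) = os_unit T \<and> completely_positive S T \<Phi> \<and>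
     (\<forall>g\<in>carrier G. \<forall>x\<in>os_carrier S. \<Phi> (\<alpha> g x) = \<beta> g (\<Phi> x))"


section \<open>The operator system of continuous functions\<close>

text \<open>
  Continuous functions are normalised to vanish outside \<open>topspace X\<close>, so that equality in
  \<open>C(X)\<close> is equality of HOL functions.  Under \<open>M\<^sub>n(C(X)) = C(X, M\<^sub>n)\<close> positivity is pointwise
  positive semidefiniteness.  The \<open>insert 0\<close> in the supremum norm only matters for the empty space.
\<close>

definition C_carrier :: "'x topology \<Rightarrow> ('x \<Rightarrow> complex) set" where
  "C_carrier X = {f. continuous_map X euclidean f \<and> (\<forall>x. x \<notin> topspace X \<longrightarrow> f x = 0)}"

definition C_system :: "'x topology \<Rightarrow> ('x \<Rightarrow> complex) op_system" where
  "C_system X =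
    \<lparr> os_carrier = C_carrier X,
      os_add = (\<lambda>f h x. f x + h x),
      os_scale = (\<lambda>a f x. a * f x),
      os_unit = (\<lambda>x. if x \<in> topspace X then 1 else 0),
      os_pos = (\<lambda>n. {F. (\<forall>i<n. \<forall>j<n. F i j \<in> C_carrier X) \<and>
                 (\<forall>x\<in>topspace X. \<forall>v :: nat \<Rightarrow> complex.
                    (\<Sum>i<n. \<Sum>j<n. cnj (v i) * F i j x * v j) \<in> \<real>\<^sub>\<ge>\<^sub>0)}),
      os_norm = (\<lambda>f. Sup (insert 0 ((\<lambda>x. cmod (f x)) ` topspace X))) \<rparr>"

definition C_action ::
  "('g, 'm) monoid_scheme \<Rightarrow> 'x topology \<Rightarrow> ('g \<Rightarrow> 'x \<Rightarrow> 'x) \<Rightarrow> 'g \<Rightarrow> ('x \<Rightarrow> complex) \<Rightarrow> 'x \<Rightarrow> complex" where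
  "C_action G X \<phi> g f = (\<lambda>x. if x \<in> topspace X then f (\<phi> (inv\<^bsub>G\<^esub> g) x) else 0)"


section \<open>The operator system of bounded operators on a complex Hilbert space of sequences\<close>

text \<open>
  Elements of \<open>\<ell>\<^sup>2(I)\<close> vanish outside \<open>I\<close> and operators vanish outside \<open>\<ell>\<^sup>2(I)\<close>; again this makes
  equality of operators equality of HOL functions.  The inner product is linear in the first argument.
\<close>

definition ell2 :: "'i set \<Rightarrow> ('i \<Rightarrow> complex) set" where
  "ell2 I = {\<xi>. (\<lambda>i. (cmod (\<xi> i))\<^sup>2) summable_on I \<and> (\<forall>i. i \<notin> I \<longrightarrow> \<xi> i = 0)}"

definition ell2_norm :: "'i set \<Rightarrow> ('i \<Rightarrow> complex) \<Rightarrow> real" where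
  "ell2_norm I \<xi> = sqrt (\<Sum>\<^sub>\<infinity>i\<in>I. (cmod (\<xi> i))\<^sup>2)"

definition ell2_inner :: "'i set \<Rightarrow> ('i \<Rightarrow> complex) \<Rightarrow> ('i \<Rightarrow> complex) \<Rightarrow> complex" where
  "ell2_inner I \<xi> \<eta> = (\<Sum>\<^sub>\<infinity>i\<in>I. \<xi> i * cnj (\<eta> i))"

definition ell2_delta :: "'i \<Rightarrow> 'i \<Rightarrow> complex" where
  "ell2_delta c = (\<lambda>i. if i = c then 1 else 0)"

definition B_carrier :: "'i set \<Rightarrow> (('i \<Rightarrow> complex) \<Rightarrow> 'i \<Rightarrow> complex) set" where
  "B_carrier I = {T.
     (\<forall>\<xi>\<in>ell2 I. T \<xi> \<in> ell2 I) \<and>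
     (\<forall>\<xi>. \<xi> \<notin> ell2 I \<longrightarrow> T \<xi> = (\<lambda>i. 0)) \<and>
     (\<forall>\<xi>\<in>ell2 I. \<forall>\<eta>\<in>ell2 I. T (\<lambda>i. \<xi> i + \<eta> i) = (\<lambda>i. T \<xi> i + T \<eta> i)) \<and>
     (\<forall>a. \<forall>\<xi>\<in>ell2 I. T (\<lambda>i. a * \<xi> i) = (\<lambda>i. a * T \<xi> i)) \<and>
     (\<exists>K. \<forall>\<xi>\<in>ell2 I. ell2_norm I (T \<xi>) \<le> K * ell2_norm I \<xi>)}"

definition B_system :: "'i set \<Rightarrow> (('i \<Rightarrow> complex) \<Rightarrow> 'i \<Rightarrow> complex) op_system" where
  "B_system I =
    \<lparr> os_carrier = B_carrier I,
      os_add = (\<lambda>S T \<xi> i. S \<xi> i + T \<xi> i),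
      os_scale = (\<lambda>a T \<xi> i. a * T \<xi> i),
      os_unit = (\<lambda>\<xi>. if \<xi> \<in> ell2 I then \<xi> else (\<lambda>i. 0)),
      os_pos = (\<lambda>n. {A. (\<forall>i<n. \<forall>j<n. A i j \<in> B_carrier I) \<and>
                 (\<forall>\<xi> :: nat \<Rightarrow> 'i \<Rightarrow> complex. (\<forall>i<n. \<xi> i \<in> ell2 I) \<longrightarrow>
                    (\<Sum>i<n. \<Sum>j<n. ell2_inner I (A i j (\<xi> j)) (\<xi> i)) \<in> \<real>\<^sub>\<ge>\<^sub>0)}),
      os_norm = (\<lambda>T. SUP \<xi>\<in>{\<xi>\<in>ell2 I. ell2_norm I \<xi> \<le> 1}. ell2_norm I (T \<xi>)) \<rparr>"


section \<open>The quasi-regular representation\<close>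

definition quasi_regular ::
  "('g, 'm) monoid_scheme \<Rightarrow> 'g set \<Rightarrow> 'g \<Rightarrow> ('g set \<Rightarrow> complex) \<Rightarrow> 'g set \<Rightarrow> complex" where
  "quasi_regular G H g \<xi> =
     (\<lambda>c. if \<xi> \<in> ell2 (lcosets\<^bsub>G\<^esub> H) \<and> c \<in> lcosets\<^bsub>G\<^esub> H then \<xi> (inv\<^bsub>G\<^esub> g <#\<^bsub>G\<^esub> c) else 0)"

lemma ell2_delta_in_ell2: "c \<in> I \<Longrightarrow> ell2_delta c \<in> ell2 I"
proof -
  assume c: "c \<in> I"
  have "(\<lambda>i. (cmod (ell2_delta c i))\<^sup>2) summable_on I \<longleftrightarrow>
        (\<lambda>i. (cmod (ell2_delta c i))\<^sup>2) summable_on {c}"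
    by (rule summable_on_cong_neutral) (use c in \<open>auto simp: ell2_delta_def\<close>)
  with c show ?thesis
    by (auto simp: ell2_def ell2_delta_def)
qed

lemma quasi_regular_delta:
  assumes "group G" and "subgroup H G" and "g \<in> carrier G" and "h \<in> carrier G"
  shows "quasi_regular G H g (ell2_delta (h <#\<^bsub>G\<^esub> H)) = ell2_delta ((g \<otimes>\<^bsub>G\<^esub> h) <#\<^bsub>G\<^esub> H)"
proof -
  interpret group G by fact
  have sub: "H \<subseteq> carrier G" using assms(2) by (rule subgroup.subset)
  have mem: "k <#\<^bsub>G\<^esub> H \<in> lcosets\<^bsub>G\<^esub> H" if "k \<in> carrier G" for k
    using that by (auto simp: LCOSETS_def)
  have eq: "inv\<^bsub>G\<^esub> g <#\<^bsub>G\<^esub> c = h <#\<^bsub>G\<^esub> H \<longleftrightarrow> c = (g \<otimes>\<^bsub>G\<^esub> h) <#\<^bsub>G\<^esub> H"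
    if c: "c \<in> lcosets\<^bsub>G\<^esub> H" for c
  proof -
    obtain k where k: "k \<in> carrier G" "c = k <#\<^bsub>G\<^esub> H"
      using c by (auto simp: LCOSETS_def)
    have "c \<subseteq> carrier G" using k sub by (simp add: l_coset_subset_G)
    then have "g <#\<^bsub>G\<^esub> (inv\<^bsub>G\<^esub> g <#\<^bsub>G\<^esub> c) = c"
      using assms by (simp add: lcos_m_assoc lcos_mult_one)
    moreover have "g <#\<^bsub>G\<^esub> (h <#\<^bsub>G\<^esub> H) = (g \<otimes>\<^bsub>G\<^esub> h) <#\<^bsub>G\<^esub> H"
      using assms sub by (simp add: lcos_m_assoc)
    moreover have "inv\<^bsub>G\<^esub> g <#\<^bsub>G\<^esub> ((g \<otimes>\<^bsub>G\<^esub> h) <#\<^bsub>G\<^esub> H) = h <#\<^bsub>G\<^esub> H"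
      using assms sub by (simp add: lcos_m_assoc m_assoc[symmetric])
    ultimately show ?thesis by metis
  qed
  show ?thesis
    using ell2_delta_in_ell2[OF mem[of h]] mem[of "g \<otimes>\<^bsub>G\<^esub> h"] assms eq
    by (auto simp: quasi_regular_def ell2_delta_def fun_eq_iff)
qed

definition B_action ::
  "('g, 'm) monoid_scheme \<Rightarrow> 'g set \<Rightarrow> 'g \<Rightarrow>
   (('g set \<Rightarrow> complex) \<Rightarrow> 'g set \<Rightarrow> complex) \<Rightarrow> ('g set \<Rightarrow> complex) \<Rightarrow> 'g set \<Rightarrow> complex" where
  "B_action G H g T = quasi_regular G H g \<circ> T \<circ> quasi_regular G H (inv\<^bsub>G\<^esub> g)"


section \<open>Boundaries\<close>

definition homeo_action ::
  "('g, 'm) monoid_scheme \<Rightarrow> 'x topology \<Rightarrow> ('g \<Rightarrow> 'x \<Rightarrow> 'x) \<Rightarrow> bool" where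
  "homeo_action G X \<phi> \<longleftrightarrow>
     group_action G (topspace X) \<phi> \<and> (\<forall>g\<in>carrier G. homeomorphic_map X X (\<phi> g))"

definition coset_boundary ::
  "('g, 'm) monoid_scheme \<Rightarrow> 'g set \<Rightarrow> 'x topology \<Rightarrow> ('g \<Rightarrow> 'x \<Rightarrow> 'x) \<Rightarrow> bool" where
  "coset_boundary G H X \<phi> \<longleftrightarrow>
     (let S = C_system X; T = B_system (lcosets\<^bsub>G\<^esub> H);
          ucp = equivariant_ucp_map G S (C_action G X \<phi>) T (B_action G H)
      in (\<exists>\<Phi>. ucp \<Phi>) \<and> (\<forall>\<Phi>. ucp \<Phi> \<longrightarrow> os_isometric S T \<Phi>))"


section \<open>Spaces of probability measures\<close>

definition borel_of :: "'x topology \<Rightarrow> 'x measure" where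
  "borel_of X = sigma (topspace X) {U. openin X U}"

definition Prob :: "'x topology \<Rightarrow> 'x measure set" where
  "Prob X = {\<nu>. prob_space \<nu> \<and> sets \<nu> = sets (borel_of X) \<and>
     (\<forall>A\<in>sets \<nu>. emeasure \<nu> A = (SUP K\<in>{K. compactin X K \<and> K \<subseteq> A}. emeasure \<nu> K))}"

definition weak_star :: "'x topology \<Rightarrow> 'x measure topology" where
  "weak_star X = pullback_topology (Prob X)
     (\<lambda>\<nu>. \<lambda>f\<in>C_carrier X. integral\<^sup>L \<nu> f)
     (product_topology (\<lambda>_. euclidean) (C_carrier X))"

definition push_measure ::
  "'x topology \<Rightarrow> ('g \<Rightarrow> 'x \<Rightarrow> 'x) \<Rightarrow> 'g \<Rightarrow> 'x measure \<Rightarrow> 'x measure" where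
  "push_measure X \<phi> g \<nu> = distr \<nu> (borel_of X) (\<phi> g)"

definition contractible_measure ::
  "('g, 'm) monoid_scheme \<Rightarrow> 'x topology \<Rightarrow> ('g \<Rightarrow> 'x \<Rightarrow> 'x) \<Rightarrow> 'x measure \<Rightarrow> bool" where
  "contractible_measure G X \<phi> \<nu> \<longleftrightarrow>
     (\<forall>x\<in>topspace X. return (borel_of X) x \<in>
        weak_star X closure_of ((\<lambda>g. push_measure X \<phi> g \<nu>) ` carrier G))"

definition Prob_contractible ::
  "('g, 'm) monoid_scheme \<Rightarrow> 'x topology \<Rightarrow> ('g \<Rightarrow> 'x \<Rightarrow> 'x) \<Rightarrow> 'x measure set" where
  "Prob_contractible G X \<phi> = {\<nu>\<in>Prob X. contractible_measure G X \<phi> \<nu>}"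

definition Prob_invariant :: "'g set \<Rightarrow> 'x topology \<Rightarrow> ('g \<Rightarrow> 'x \<Rightarrow> 'x) \<Rightarrow> 'x measure set" where
  "Prob_invariant H X \<phi> = {\<nu>\<in>Prob X. \<forall>h\<in>H. push_measure X \<phi> h \<nu> = \<nu>}"

end

theory Submission
  imports Defs
begin

text \<open>The two conditions are linked by a correspondence between \<open>H\<close>-invariant Radon probability measures
  on \<open>X\<close> and equivariant ucp maps into \<open>B(\<ell>\<^sup>2(G/H))\<close>.

  A measure \<open>\<nu> \<in> Prob_invariant H X \<phi>\<close> yields the Poisson map, which sends \<open>f\<close> to the multiplication
  operator by the function \<open>g H \<mapsto> \<integral> f(g x) d\<nu>(x)\<close> on \<open>G/H\<close>; it is an equivariant ucp map
  (lemma \<open>poisson_ucp\<close>).  Conversely, an equivariant ucp map \<open>\<Phi>\<close> is compressed by the unit vector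
  \<open>\<delta>\<^sub>H\<close> to a state of \<open>C(X)\<close>; the Riesz representation theorem turns the state into a measure
  \<open>\<nu>\<close>, which is invariant because \<open>H\<close> fixes \<open>\<delta>\<^sub>H\<close>, and by equivariance the diagonal
  entry of \<open>\<Phi> f\<close> at \<open>g H\<close> is \<open>\<integral> f(g x) d\<nu>(x)\<close> (lemma \<open>ucp_measure\<close>).

  If every invariant measure is contractible, these diagonal entries come arbitrarily close to each value
  \<open>f(x)\<close>, so \<open>\<parallel>\<Phi> f\<parallel> \<ge> \<parallel>f\<parallel>\<close>; the opposite inequality is the contractivity of ucp maps
  (lemmas \<open>cp_contractive\<close> and \<open>ucp_isometric\<close>).  If, on the other hand, the Poisson map of \<open>\<nu>\<close>
  is isometric, then for finitely many functions \<open>f\<close> and a point \<open>x\<close> put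
  \<open>s(y) = \<Sum> |f(y) - f(x)|\<close> and apply isometry to \<open>M - s\<close> for a large constant \<open>M\<close>.  This
  function has norm at least \<open>M\<close>, so \<open>\<integral> s(g y) d\<nu>(y)\<close> is small for some \<open>g\<close>, that is, the
  translate of \<open>\<nu>\<close> by \<open>g\<close> is close to the point mass at \<open>x\<close> on all the given functions (lemma
  \<open>isometric_contractible\<close>).

  The Riesz representation theorem is developed for positive functionals on the continuous functions of a
  compact Hausdorff topology by the classical construction: a content on open sets, the induced outer measure,
  Caratheodory's criterion, and a decomposition of a function along its level sets.\<close>

section \<open>Borel sets and continuous functions\<close>

lemma space_borel_of [simp]: "space (borel_of X) = topspace X"
  by (simp add: borel_of_def space_measure_of_conv)

lemma sets_borel_of: "sets (borel_of X) = sigma_sets (topspace X) {U. openin X U}"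
  unfolding borel_of_def by (rule sets_measure_of) (auto dest: openin_subset)

lemma openin_sets_borel_of: "openin X U \<Longrightarrow> U \<in> sets (borel_of X)"
  by (auto simp: sets_borel_of)

lemma closedin_sets_borel_of:
  assumes "closedin X K" shows "K \<in> sets (borel_of X)"
proof -
  have "topspace X - (topspace X - K) \<in> sets (borel_of X)"
    using assms by (metis openin_sets_borel_of closedin_def sets.compl_sets space_borel_of)
  then show ?thesis
    using closedin_subset[OF assms] by (simp add: double_diff)
qed

lemma continuous_map_measurable:
  assumes "sets M = sets (borel_of X)" and "continuous_map X euclidean f"
  shows "f \<in> borel_measurable M"
proof (rule borel_measurableI)
  fix S :: "'b set" assume "open S"
  moreover have "space M = topspace X"
    using sets_eq_imp_space_eq[OF assms(1)] by simp
  ultimately have "openin X (f -` S \<inter> space M)"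
    using openin_continuous_map_preimage[OF assms(2), of S] by (simp add: vimage_def Int_def conj_commute)
  then show "f -` S \<inter> space M \<in> sets M"
    by (simp add: assms(1) openin_sets_borel_of)
qed

lemma continuous_map_bounded:
  fixes f :: "'x \<Rightarrow> 'b::real_normed_vector"
  assumes "compact_space X" and "continuous_map X euclidean f"
  obtains B where "0 < B" "\<And>x. x \<in> topspace X \<Longrightarrow> norm (f x) \<le> B"
proof -
  have "compactin euclidean (f ` topspace X)"
    using assms by (intro image_compactin) (auto simp: compact_space_def)
  then have "bounded (f ` topspace X)" by (simp add: compact_imp_bounded)
  then show ?thesis
    using that by (auto simp: bounded_pos)
qed

lemma continuous_map_integrable:
  fixes f :: "'x \<Rightarrow> 'b::{banach, second_countable_topology}"
  assumes "finite_measure M" and "sets M = sets (borel_of X)"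
    and "compact_space X" and "continuous_map X euclidean f"
  shows "integrable M f"
proof -
  interpret finite_measure M by fact
  obtain B where "\<And>x. x \<in> topspace X \<Longrightarrow> norm (f x) \<le> B"
    using continuous_map_bounded[OF assms(3,4)] by blast
  moreover have "space M = topspace X"
    using sets_eq_imp_space_eq[OF assms(2)] by simp
  ultimately show ?thesis
    using continuous_map_measurable[OF assms(2,4)] by (intro integrable_const_bound[of _ B]) auto
qed

lemma urysohn:
  assumes "compact_space X" "Hausdorff_space X" "closedin X K" "openin X U" "K \<subseteq> U"
  obtains h :: "'x \<Rightarrow> real" where "continuous_map X euclideanreal h"
    "\<And>x. x \<in> topspace X \<Longrightarrow> 0 \<le> h x \<and> h x \<le> 1"
    "\<And>x. x \<in> topspace X - U \<Longrightarrow> h x = 0" "\<And>x. x \<in> K \<Longrightarrow> h x = 1"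
proof -
  have "normal_space X"
    using assms(1,2) compact_Hausdorff_or_regular_imp_normal_space by blast
  moreover have "closedin X (topspace X - U)" using assms(4) by blast
  moreover have "disjnt (topspace X - U) K" using assms(5) by (auto simp: disjnt_def)
  ultimately obtain h where "continuous_map X (top_of_set {0..1::real}) h"
     "h ` (topspace X - U) \<subseteq> {0}" "h ` K \<subseteq> {1}"
    using Urysohn_lemma[OF _ _ assms(3), of "topspace X - U" 0 1] zero_le_one by metis
  then show ?thesis
    by (intro that[of h]) (auto simp: continuous_map_in_subtopology)
qed

lemma ennreal_le_plus:
  "a \<le> b + d \<Longrightarrow> 0 \<le> b \<Longrightarrow> 0 \<le> d \<Longrightarrow> ennreal a \<le> ennreal b + ennreal d"
  by (metis ennreal_leI ennreal_plus)

section \<open>The Riesz representation theorem\<close>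

text \<open>A positive linear functional on the real continuous functions of a compact Hausdorff space.  The
  functional is applied to functions on the whole type; monotonicity, which only compares values on the
  space, makes it insensitive to values elsewhere.\<close>

locale positive_functional =
  fixes X :: "'x topology" and L :: "('x \<Rightarrow> real) \<Rightarrow> real"
  assumes compact: "compact_space X" and Hausdorff: "Hausdorff_space X"
    and add: "\<And>f g. continuous_map X euclideanreal f \<Longrightarrow> continuous_map X euclideanreal g
               \<Longrightarrow> L (\<lambda>x. f x + g x) = L f + L g"
    and scale: "\<And>c f. continuous_map X euclideanreal f \<Longrightarrow> L (\<lambda>x. c * f x) = c * L f"
    and mono: "\<And>f g. continuous_map X euclideanreal f \<Longrightarrow> continuous_map X euclideanreal g
               \<Longrightarrow> (\<And>x. x \<in> topspace X \<Longrightarrow> f x \<le> g x) \<Longrightarrow> L f \<le> L g"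
begin

abbreviation total :: real where "total \<equiv> L (\<lambda>_. 1)"

text \<open>The continuous functions dominated by the indicator function of \<open>U\<close>.  Vanishing outside \<open>U\<close> is
  required, but not support inside \<open>U\<close>; cutting off makes up for the difference.\<close>

definition below :: "'x set \<Rightarrow> ('x \<Rightarrow> real) set" where
  "below U = {f. continuous_map X euclideanreal f \<and> (\<forall>x\<in>topspace X. 0 \<le> f x \<and> f x \<le> 1) \<and>
     (\<forall>x\<in>topspace X - U. f x = 0)}"

text \<open>The value at an open set \<open>U\<close> of the measure to be constructed.\<close>

definition open_content :: "'x set \<Rightarrow> ennreal" where
  "open_content U = (SUP f\<in>below U. ennreal (L f))"

text \<open>The outer measure obtained from the content by approximation with open sets from outside.\<close>

definition outer :: "'x set \<Rightarrow> ennreal" where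
  "outer A = (INF U\<in>{U. openin X U \<and> A \<subseteq> U}. open_content U)"

lemma L_cong:
  assumes "continuous_map X euclideanreal f" "continuous_map X euclideanreal g"
    "\<And>x. x \<in> topspace X \<Longrightarrow> f x = g x"
  shows "L f = L g"
  using mono[of f g] mono[of g f] assms by (simp add: order_antisym)

lemma L_zero: "L (\<lambda>_. 0) = 0"
  using scale[of "\<lambda>_. 0" 0] by simp

lemma L_const: "L (\<lambda>_. c) = c * total"
  using scale[of "\<lambda>_. 1" c] by simp

lemma L_diff:
  assumes "continuous_map X euclideanreal f" "continuous_map X euclideanreal g"
  shows "L (\<lambda>x. f x - g x) = L f - L g"
  using add[OF assms(1), of "\<lambda>x. (-1) * g x"] scale[OF assms(2), of "-1"] assms
  by (simp add: continuous_map_minus)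

lemma L_nonneg:
  assumes "continuous_map X euclideanreal f" "\<And>x. x \<in> topspace X \<Longrightarrow> 0 \<le> f x"
  shows "0 \<le> L f"
  using mono[of "\<lambda>_. 0" f] assms L_zero by simp

lemma total_nonneg: "0 \<le> total"
  by (rule L_nonneg) auto

lemma below_cont: "f \<in> below U \<Longrightarrow> continuous_map X euclideanreal f"
  and below_nonneg: "f \<in> below U \<Longrightarrow> x \<in> topspace X \<Longrightarrow> 0 \<le> f x"
  and below_le_1: "f \<in> below U \<Longrightarrow> x \<in> topspace X \<Longrightarrow> f x \<le> 1"
  and below_outside: "f \<in> below U \<Longrightarrow> x \<in> topspace X \<Longrightarrow> x \<notin> U \<Longrightarrow> f x = 0"
  by (auto simp: below_def)

lemma zero_below: "(\<lambda>_. 0) \<in> below U"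
  by (simp add: below_def)

lemma below_L_nonneg: "f \<in> below U \<Longrightarrow> 0 \<le> L f"
  by (intro L_nonneg) (auto simp: below_def)

lemma below_L_le: "f \<in> below U \<Longrightarrow> L f \<le> total"
  by (intro mono) (auto simp: below_def)

lemma le_open_content: "f \<in> below U \<Longrightarrow> ennreal (L f) \<le> open_content U"
  unfolding open_content_def by (rule SUP_upper)

lemma open_content_mono: "U \<subseteq> V \<Longrightarrow> open_content U \<le> open_content V"
  unfolding open_content_def by (rule SUP_subset_mono) (auto simp: below_def)

lemma open_content_le: "open_content U \<le> ennreal total"
  unfolding open_content_def by (rule SUP_least) (intro ennreal_leI below_L_le)

lemma open_content_topspace: "open_content (topspace X) = ennreal total"
proof (rule antisym[OF open_content_le le_open_content])
  show "(\<lambda>_. 1) \<in> below (topspace X)" by (simp add: below_def)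
qed

lemma open_content_empty: "open_content {} = 0"
proof -
  have "L f = 0" if "f \<in> below {}" for f
    using that L_cong[of f "\<lambda>_. 0"] L_zero by (auto simp: below_def)
  then show ?thesis
    unfolding open_content_def using zero_below[of "{}"] by (auto simp: SUP_constant)
qed

lemma superlevel_closed:
  assumes "continuous_map X euclideanreal f"
  shows "closedin X {x \<in> topspace X. e \<le> f x}"
  using closedin_continuous_map_preimage[OF assms, of "{e..}"] by simp

lemma superlevel_open:
  assumes "continuous_map X euclideanreal f"
  shows "openin X {x \<in> topspace X. e < f x}"
  using openin_continuous_map_preimage[OF assms, of "{e<..}"] by simp

text \<open>The function \<open>(f - e)\<^sup>+\<close> is supported in the compact set where \<open>f \<ge> e\<close>, and its value
  under the functional is close to that of \<open>f\<close>.\<close>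

lemma cutoff:
  assumes f: "f \<in> below U" and "0 < e"
    and V: "{x \<in> topspace X. e \<le> f x} \<subseteq> V"
  shows "(\<lambda>x. max (f x - e) 0) \<in> below V"
    and "L f \<le> L (\<lambda>x. max (f x - e) 0) + e * total"
proof -
  have c: "continuous_map X euclideanreal (\<lambda>x. max (f x - e) 0)"
    by (intro continuous_intros below_cont[OF f]) auto
  have "max (f x - e) 0 = 0" if "x \<in> topspace X - V" for x
    using that V by force
  with c show "(\<lambda>x. max (f x - e) 0) \<in> below V"
    using f \<open>0 < e\<close> by (fastforce simp: below_def)
  have "L f \<le> L (\<lambda>x. max (f x - e) 0 + e)"
    using c by (intro mono below_cont[OF f]) (auto intro!: continuous_intros)
  also have "\<dots> = L (\<lambda>x. max (f x - e) 0) + e * total"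
    using c by (simp add: add L_const[of e])
  finally show "L f \<le> L (\<lambda>x. max (f x - e) 0) + e * total" .
qed

lemma urysohn_below:
  assumes "closedin X K" "openin X U" "K \<subseteq> U"
  obtains h where "h \<in> below U" "\<And>x. x \<in> K \<Longrightarrow> h x = 1"
proof (rule urysohn[OF compact Hausdorff assms])
  fix h :: "'x \<Rightarrow> real"
  assume "continuous_map X euclideanreal h" "\<And>x. x \<in> topspace X \<Longrightarrow> 0 \<le> h x \<and> h x \<le> 1"
    "\<And>x. x \<in> topspace X - U \<Longrightarrow> h x = 0" and 1: "\<And>x. x \<in> K \<Longrightarrow> h x = 1"
  then have "h \<in> below U" by (simp add: below_def)
  then show thesis using 1 by (rule that)
qed

text \<open>After a cut-off, a function below \<open>U \<union> V\<close> splits as the sum of one below \<open>U\<close> and one below \<open>V\<close>: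
  multiply it by a Urysohn function \<open>h\<close> below \<open>U\<close> that is \<open>1\<close> where \<open>f \<ge> e\<close> outside \<open>V\<close>,
  and by \<open>1 - h\<close>.\<close>

lemma open_content_Un:
  assumes U: "openin X U" and V: "openin X V"
  shows "open_content (U \<union> V) \<le> open_content U + open_content V"
  unfolding open_content_def[of "U \<union> V"]
proof (rule SUP_least)
  fix f assume f: "f \<in> below (U \<union> V)"
  show "ennreal (L f) \<le> open_content U + open_content V"
  proof (rule ennreal_le_epsilon)
    fix d :: real assume "0 < d"
    \<comment> \<open>The denominator is \<open>total + 1\<close> because \<open>total\<close> may vanish.\<close>
    define e where "e = d / (total + 1)"
    have e: "0 < e" "e * total \<le> d"
      using \<open>0 < d\<close> total_nonneg by (auto simp: e_def field_simps)
    define K where "K = {x \<in> topspace X. e \<le> f x}"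
    have "K \<subseteq> U \<union> V"
      using below_outside[OF f] e by (force simp: K_def)
    moreover have "closedin X (K - V)"
      unfolding K_def by (intro closedin_diff superlevel_closed below_cont[OF f] V)
    ultimately obtain h where h: "h \<in> below U" "\<And>x. x \<in> K - V \<Longrightarrow> h x = 1"
      using urysohn_below[of "K - V" U] U by blast
    define u where "u = (\<lambda>x. max (f x - e) 0)"
    have cu: "continuous_map X euclideanreal u"
      unfolding u_def by (intro continuous_intros below_cont[OF f]) auto
    note hc = below_cont[OF h(1)]
    have u01: "0 \<le> u x" "u x \<le> 1" if "x \<in> topspace X" for x
      using below_le_1[OF f that] e by (auto simp: u_def)
    have "(\<lambda>x. u x * h x) \<in> below U"
      using h(1) u01 cu hc by (auto simp: below_def intro!: continuous_intros mult_le_one)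
    moreover have "(\<lambda>x. u x * (1 - h x)) \<in> below V"
    proof -
      have "u x * (1 - h x) = 0" if "x \<in> topspace X - V" for x
        using h(2)[of x] that by (cases "x \<in> K") (auto simp: K_def u_def)
      moreover have "continuous_map X euclideanreal (\<lambda>x. u x * (1 - h x))"
        using cu hc by (intro continuous_intros) auto
      ultimately show ?thesis
        using h(1) u01 by (auto simp: below_def intro!: mult_le_one)
    qed
    ultimately have "ennreal (L (\<lambda>x. u x * h x)) \<le> open_content U"
      "ennreal (L (\<lambda>x. u x * (1 - h x))) \<le> open_content V"
      and nn: "0 \<le> L (\<lambda>x. u x * h x)" "0 \<le> L (\<lambda>x. u x * (1 - h x))"
      by (auto intro: le_open_content below_L_nonneg)
    then have "ennreal (L (\<lambda>x. u x * h x) + L (\<lambda>x. u x * (1 - h x))) + ennreal d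
        \<le> open_content U + open_content V + ennreal d"
      by (auto simp: ennreal_plus intro!: add_mono)
    moreover have "L f \<le> L (\<lambda>x. u x * h x) + L (\<lambda>x. u x * (1 - h x)) + d"
    proof -
      have "L f \<le> L u + e * total"
        unfolding u_def by (rule cutoff(2)[OF f e(1) order_refl])
      also have "L u = L (\<lambda>x. u x * h x + u x * (1 - h x))"
        by (rule arg_cong[of _ _ L]) (simp add: algebra_simps)
      also have "\<dots> = L (\<lambda>x. u x * h x) + L (\<lambda>x. u x * (1 - h x))"
        using cu hc by (intro add continuous_intros) auto
      finally show ?thesis using e(2) by linarith
    qed
    then have "ennreal (L f) \<le> ennreal (L (\<lambda>x. u x * h x) + L (\<lambda>x. u x * (1 - h x))) + ennreal d"
      using nn \<open>0 < d\<close> by (intro ennreal_le_plus) auto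
    ultimately show "ennreal (L f) \<le> open_content U + open_content V + ennreal d"
      by (rule order_trans[rotated])
  qed
qed

lemma open_content_finite_UN:
  assumes "\<And>i::nat. openin X (U i)"
  shows "open_content (\<Union>i<n. U i) \<le> (\<Sum>i<n. open_content (U i))"
proof (induction n)
  case (Suc n)
  have "open_content (\<Union>i<Suc n. U i) = open_content ((\<Union>i<n. U i) \<union> U n)"
    by (simp add: lessThan_Suc Un_commute)
  also have "\<dots> \<le> open_content (\<Union>i<n. U i) + open_content (U n)"
    using assms by (intro open_content_Un) auto
  finally show ?case using Suc by (auto intro: order_trans add_right_mono)
qed (simp add: open_content_empty)

lemma open_content_UN:
  assumes U: "\<And>i::nat. openin X (U i)"
  shows "open_content (\<Union>i. U i) \<le> (\<Sum>i. open_content (U i))"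
  unfolding open_content_def[of "\<Union>i. U i"]
proof (rule SUP_least)
  fix f assume f: "f \<in> below (\<Union>i. U i)"
  \<comment> \<open>After a cut-off, compactness reduces the union to a finite one.\<close>
  show "ennreal (L f) \<le> (\<Sum>i. open_content (U i))"
  proof (rule ennreal_le_epsilon)
    fix d :: real assume "0 < d"
    define e where "e = d / (total + 1)"
    have e: "0 < e" "e * total \<le> d"
      using \<open>0 < d\<close> total_nonneg by (auto simp: e_def field_simps)
    define K where "K = {x \<in> topspace X. e \<le> f x}"
    have "K \<subseteq> (\<Union>i. U i)"
      using below_outside[OF f] e by (force simp: K_def)
    moreover have "compactin X K"
      unfolding K_def by (intro closedin_compact_space compact superlevel_closed below_cont[OF f])
    ultimately obtain \<F> where F: "finite \<F>" "\<F> \<subseteq> range U" "K \<subseteq> \<Union>\<F>"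
      using compactinD[of X K "range U"] U by blast
    then obtain I where I: "finite I" "\<F> = U ` I"
      by (meson finite_subset_image)
    then obtain n where "I \<subseteq> {..<n}"
      using finite_nat_bounded by blast
    with F I have "K \<subseteq> (\<Union>i<n. U i)" by blast
    note c = cutoff[OF f e(1) this[unfolded K_def]]
    have "ennreal (L f) \<le> ennreal (L (\<lambda>x. max (f x - e) 0)) + ennreal d"
      using c(2) e(2) below_L_nonneg[OF c(1)] \<open>0 < d\<close>
      by (intro ennreal_le_plus) auto
    also have "ennreal (L (\<lambda>x. max (f x - e) 0)) \<le> (\<Sum>i<n. open_content (U i))"
      using le_open_content[OF c(1)] open_content_finite_UN[of U n, OF U] by (rule order_trans)
    also have "\<dots> \<le> (\<Sum>i. open_content (U i))"
      by (rule sum_le_suminf) auto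
    finally show "ennreal (L f) \<le> (\<Sum>i. open_content (U i)) + ennreal d"
      by (simp add: add_right_mono)
  qed
qed

lemma outer_le: "openin X U \<Longrightarrow> A \<subseteq> U \<Longrightarrow> outer A \<le> open_content U"
  unfolding outer_def by (rule INF_lower) auto

lemma outer_open: "openin X U \<Longrightarrow> outer U = open_content U"
  by (rule antisym[OF outer_le]) (auto simp: outer_def intro!: INF_greatest open_content_mono)

lemma outer_mono: "A \<subseteq> B \<Longrightarrow> outer A \<le> outer B"
  unfolding outer_def by (rule INF_superset_mono) auto

lemma outer_approx:
  assumes "outer A < c"
  obtains U where "openin X U" "A \<subseteq> U" "open_content U < c"
  using assms unfolding outer_def INF_less_iff by auto

lemma outer_finite: "A \<subseteq> topspace X \<Longrightarrow> outer A < \<infinity>"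
  using outer_le[of "topspace X" A] open_content_topspace
  by (metis ennreal_less_top infinity_ennreal_def le_less_trans openin_topspace)

lemma outer_measure_space: "outer_measure_space (Pow (topspace X)) outer"
  unfolding outer_measure_space_def
proof (intro conjI)
  show "positive (Pow (topspace X)) outer"
    by (simp add: positive_def outer_open open_content_empty)
  show "increasing (Pow (topspace X)) outer"
    by (simp add: increasing_def outer_mono)
  show "countably_subadditive (Pow (topspace X)) outer"
    unfolding countably_subadditive_def
  proof (intro allI impI)
    fix A :: "nat \<Rightarrow> 'x set"
    assume A: "range A \<subseteq> Pow (topspace X)"
    show "outer (\<Union>i. A i) \<le> (\<Sum>i. outer (A i))"
    proof (rule ennreal_le_epsilon)
      fix e :: real assume e: "0 < e"
      have "\<exists>U. openin X U \<and> A n \<subseteq> U \<and> open_content U < outer (A n) + ennreal (e * (1/2) ^ Suc n)" for n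
      proof -
        have "outer (A n) < \<infinity>" using A by (intro outer_finite) auto
        then have "outer (A n) < outer (A n) + ennreal (e * (1/2) ^ Suc n)"
          using e by (simp add: ennreal_add_left_cancel_less less_top)
        then show ?thesis by (rule outer_approx) blast
      qed
      then obtain U where U: "\<And>n. openin X (U n)" "\<And>n. A n \<subseteq> U n"
        "\<And>n. open_content (U n) < outer (A n) + ennreal (e * (1/2) ^ Suc n)"
        by metis
      have "outer (\<Union>i. A i) \<le> open_content (\<Union>i. U i)"
        using U by (intro outer_le) auto
      also have "\<dots> \<le> (\<Sum>i. open_content (U i))"
        by (rule open_content_UN[OF U(1)])
      also have "\<dots> \<le> (\<Sum>i. outer (A i) + ennreal (e * (1/2) ^ Suc i))"
        using U(3) by (intro suminf_le) (auto intro: less_imp_le)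
      also have "\<dots> = (\<Sum>i. outer (A i)) + (\<Sum>i. ennreal (e * (1/2) ^ Suc i))"
        by (subst suminf_add) auto
      also have "(\<Sum>i. ennreal (e * (1/2) ^ Suc i)) = ennreal e"
        using sums_mult[OF power_half_series, of e] e by (intro suminf_ennreal_eq) auto
      finally show "outer (\<Union>i. A i) \<le> (\<Sum>i. outer (A i)) + ennreal e" .
    qed
  qed
qed

text \<open>Take functions \<open>f\<close> below \<open>V \<inter> U\<close> and \<open>g\<close> below the complement in \<open>V\<close> of the compact set
  \<open>f \<ge> e\<close>.  Then \<open>(f - e)\<^sup>+ + g\<close> is below \<open>V\<close>.  Letting \<open>f\<close> and \<open>g\<close> vary gives the
  inequality that makes open sets measurable in the sense of Caratheodory.\<close>

lemma open_content_split:
  assumes U: "openin X U" and V: "openin X V"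
  shows "outer (V \<inter> U) + outer (V - U) \<le> open_content V"
proof -
  have "outer (V - U) + ennreal (L f) \<le> open_content V" if f: "f \<in> below (V \<inter> U)" for f
  proof (rule ennreal_le_epsilon)
    fix d :: real assume "0 < d"
    define e where "e = d / (total + 1)"
    have e: "0 < e" "e * total \<le> d"
      using \<open>0 < d\<close> total_nonneg by (auto simp: e_def field_simps)
    define K where "K = {x \<in> topspace X. e \<le> f x}"
    have K: "K \<subseteq> V \<inter> U"
      using below_outside[OF f] e by (force simp: K_def)
    define u where "u = (\<lambda>x. max (f x - e) 0)"
    have cu: "continuous_map X euclideanreal u"
      unfolding u_def by (intro continuous_intros below_cont[OF f]) auto
    have oW: "openin X (V - K)"
      unfolding K_def by (intro openin_diff V superlevel_closed below_cont[OF f])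
    have g: "ennreal (L u) + ennreal (L g) \<le> open_content V" if g: "g \<in> below (V - K)" for g
    proof -
      have "(\<lambda>x. u x + g x) \<in> below V"
      proof -
        have "0 \<le> u x + g x \<and> u x + g x \<le> 1 \<and> (x \<notin> V \<longrightarrow> u x + g x = 0)" if x: "x \<in> topspace X" for x
        proof (cases "x \<in> K")
          case True
          then show ?thesis
            using below_outside[OF g x] below_le_1[OF f x] e K by (auto simp: u_def)
        next
          case False
          then have "u x = 0" using x by (auto simp: u_def K_def)
          then show ?thesis
            using below_nonneg[OF g x] below_le_1[OF g x] below_outside[OF g x] by auto
        qed
        then show ?thesis
          using cu below_cont[OF g] by (auto simp: below_def intro!: continuous_intros)
      qed
      then have "ennreal (L (\<lambda>x. u x + g x)) \<le> open_content V"
        by (rule le_open_content)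
      moreover have "0 \<le> L u" "0 \<le> L g"
        using cu below_L_nonneg[OF g] by (auto intro!: L_nonneg simp: u_def)
      ultimately show ?thesis
        using cu below_cont[OF g] by (simp add: add ennreal_plus)
    qed
    have Lf: "ennreal (L f) \<le> ennreal (L u) + ennreal d"
    proof -
      have "L f \<le> L u + d"
        using cutoff(2)[OF f e(1) order_refl] e(2) by (simp add: u_def)
      moreover have "0 \<le> L u" using cu by (intro L_nonneg) (auto simp: u_def)
      ultimately show ?thesis
        using \<open>0 < d\<close> by (intro ennreal_le_plus) auto
    qed
    have "outer (V - U) \<le> open_content (V - K)"
      using K oW by (intro outer_le) auto
    then have "outer (V - U) + ennreal (L f) \<le> open_content (V - K) + (ennreal (L u) + ennreal d)"
      using Lf by (rule add_mono)
    also have "\<dots> = (ennreal (L u) + open_content (V - K)) + ennreal d"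
      by (simp add: ac_simps)
    also have "ennreal (L u) + open_content (V - K) \<le> open_content V"
      unfolding open_content_def[of "V - K"]
    proof (subst ennreal_SUP_add_right)
      show "below (V - K) \<noteq> {}" using zero_below by blast
    qed (rule SUP_least[OF g])
    finally show "outer (V - U) + ennreal (L f) \<le> open_content V + ennreal d"
      by (simp add: add_right_mono)
  qed
  then have "outer (V - U) + open_content (V \<inter> U) \<le> open_content V"
    unfolding open_content_def[of "V \<inter> U"]
  proof (subst ennreal_SUP_add_right)
    show "below (V \<inter> U) \<noteq> {}" using zero_below by blast
  qed (rule SUP_least)
  then show ?thesis
    using U V by (simp add: outer_open openin_Int add.commute)
qed

lemma open_in_lambda_system:
  assumes U: "openin X U"
  shows "U \<in> lambda_system (topspace X) (Pow (topspace X)) outer"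
proof -
  interpret sigma_algebra "topspace X" "Pow (topspace X)" by (rule sigma_algebra_Pow)
  have "outer (A \<inter> U) + outer (A - U) = outer A" if A: "A \<subseteq> topspace X" for A
  proof (rule antisym)
    show "outer (A \<inter> U) + outer (A - U) \<le> outer A"
      unfolding outer_def[of A]
    proof (rule INF_greatest)
      fix V assume "V \<in> {V. openin X V \<and> A \<subseteq> V}"
      then have "outer (A \<inter> U) + outer (A - U) \<le> outer (V \<inter> U) + outer (V - U)"
        by (intro add_mono outer_mono) auto
      with open_content_split[OF U, of V] \<open>V \<in> _\<close>
      show "outer (A \<inter> U) + outer (A - U) \<le> open_content V"
        by auto
    qed
    have "subadditive (Pow (topspace X)) outer"
      using outer_measure_space countably_subadditive_subadditive
      by (auto simp: outer_measure_space_def)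
    from subadditiveD[OF this, of "A \<inter> U" "A - U"] A
    show "outer A \<le> outer (A \<inter> U) + outer (A - U)"
      by (auto simp: Int_Diff_Un)
  qed
  then show ?thesis
    using openin_subset[OF U] by (simp add: lambda_system_eq)
qed

text \<open>The restriction of the outer measure to the Borel sets.\<close>

definition riesz_measure :: "'x measure" where
  "riesz_measure = measure_of (topspace X) {U. openin X U} outer"

lemma sets_riesz_measure: "sets riesz_measure = sets (borel_of X)"
  by (simp add: riesz_measure_def borel_of_def sets_measure_of_conv)

lemma space_riesz_measure: "space riesz_measure = topspace X"
  using sets_eq_imp_space_eq[OF sets_riesz_measure] by simp

lemma emeasure_riesz_measure:
  assumes "A \<in> sets (borel_of X)" shows "emeasure riesz_measure A = outer A"
proof -
  interpret P: sigma_algebra "topspace X" "Pow (topspace X)" by (rule sigma_algebra_Pow)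
  have sub: "{U. openin X U} \<subseteq> Pow (topspace X)" by (auto dest: openin_subset)
  define N where "N = lambda_system (topspace X) (Pow (topspace X)) outer"
  have N: "measure_space (topspace X) N outer"
    unfolding N_def by (rule P.caratheodory_lemma[OF outer_measure_space])
  then have sN: "sigma_algebra (topspace X) N" by (simp add: measure_space_def)
  have "sigma_sets (topspace X) {U. openin X U} \<subseteq> N"
    using open_in_lambda_system by (intro sigma_algebra.sigma_sets_subset[OF sN]) (auto simp: N_def)
  from measure_down[OF N sigma_algebra_sigma_sets[OF sub] this]
  have "measure_space (topspace X) (sigma_sets (topspace X) {U. openin X U}) outer" .
  with assms show ?thesis
    unfolding riesz_measure_def sets_borel_of emeasure_measure_of_conv by (simp only: if_True simp_thms)
qed

lemma emeasure_riesz_topspace: "emeasure riesz_measure (topspace X) = ennreal total"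
  by (simp add: emeasure_riesz_measure openin_sets_borel_of outer_open open_content_topspace)

sublocale riesz: finite_measure riesz_measure
  by (rule finite_measureI) (simp add: space_riesz_measure emeasure_riesz_topspace)

lemma measure_riesz_topspace: "measure riesz_measure (topspace X) = total"
  by (simp add: measure_def emeasure_riesz_topspace total_nonneg)

lemma le_measure_riesz:
  assumes "f \<in> below U" and "openin X U"
  shows "L f \<le> measure riesz_measure U"
proof -
  have "ennreal (L f) \<le> emeasure riesz_measure U"
    using assms by (simp add: emeasure_riesz_measure openin_sets_borel_of outer_open le_open_content)
  then show ?thesis
    by (simp add: riesz.emeasure_eq_measure)
qed

text \<open>Outer regularity holds by construction of \<open>outer\<close>; taking complements gives inner regularity, as the
  measure is finite and closed sets are compact.\<close>

lemma riesz_measure_inner_regular: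
  assumes A: "A \<in> sets (borel_of X)"
  shows "emeasure riesz_measure A =
    (SUP K\<in>{K. compactin X K \<and> K \<subseteq> A}. emeasure riesz_measure K)"
proof (rule ennreal_approx_SUP)
  let ?\<mu> = "emeasure riesz_measure"
  note [simp] = sets_riesz_measure space_riesz_measure
  show "?\<mu> K \<le> ?\<mu> A" if "K \<in> {K. compactin X K \<and> K \<subseteq> A}" for K
    using that A by (intro emeasure_mono) auto
  fix e :: real assume "0 < e"
  define B where "B = topspace X - A"
  have AX: "A \<subseteq> topspace X"
    using sets.sets_into_space[OF A] by simp
  have B: "B \<in> sets (borel_of X)"
    using A sets.compl_sets[OF A] by (simp add: B_def)
  have "outer B < outer B + ennreal e"
    using outer_finite[of B] \<open>0 < e\<close> by (simp add: B_def ennreal_add_left_cancel_less less_top)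
  then obtain U where U: "openin X U" "B \<subseteq> U" "open_content U < outer B + ennreal e"
    by (rule outer_approx)
  have Ub: "U \<in> sets (borel_of X)" by (rule openin_sets_borel_of[OF U(1)])
  have "?\<mu> (U - B) + ?\<mu> B = ?\<mu> U"
    using U(2) Ub B plus_emeasure[of "U - B" riesz_measure B] by (auto simp: Un_absorb2)
  also have "\<dots> \<le> ennreal e + ?\<mu> B"
    using U B Ub by (simp add: emeasure_riesz_measure outer_open add.commute)
  finally have d: "?\<mu> (U - B) \<le> ennreal e"
    using \<open>0 < e\<close> by (simp add: riesz.emeasure_eq_measure flip: ennreal_plus)
  define K where "K = topspace X - U"
  have "closedin X K" unfolding K_def using U(1) by blast
  then have K: "compactin X K" "K \<in> sets (borel_of X)"
    by (auto intro: closedin_compact_space compact closedin_sets_borel_of)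
  have "?\<mu> A \<le> ?\<mu> (K \<union> (U - B))"
    using A B K Ub AX by (intro emeasure_mono) (auto simp: K_def B_def)
  also have "\<dots> \<le> ?\<mu> K + ?\<mu> (U - B)"
    using B K Ub by (intro emeasure_subadditive) auto
  also have "\<dots> \<le> ?\<mu> K + ennreal e"
    using d by (intro add_left_mono)
  finally have "?\<mu> A \<le> ?\<mu> K + ennreal e" .
  moreover have "K \<subseteq> A" using U(2) by (auto simp: K_def B_def)
  ultimately show "\<exists>K\<in>{K. compactin X K \<and> K \<subseteq> A}. ?\<mu> A \<le> ?\<mu> K + ennreal e"
    using K by blast
qed

lemma integrable_riesz:
  fixes f :: "'x \<Rightarrow> real"
  assumes "continuous_map X euclideanreal f" shows "integrable riesz_measure f"
  by (rule continuous_map_integrable[OF riesz.finite_measure_axioms sets_riesz_measure compact assms])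

text \<open>The function \<open>f\<close> is cut at the levels \<open>k/n\<close> into slices.  Multiplied by \<open>n\<close>, the slice between
  \<open>k/n\<close> and \<open>(k+1)/n\<close> is below the open set \<open>f > k/n\<close> and equals \<open>1\<close> where \<open>f > (k+1)/n\<close>.
  Hence the functional exceeds the integral on this slice by at most \<open>1/n\<close> times the measure of
  \<open>f > k/n\<close> less that of \<open>f > (k+1)/n\<close>, and the sum of these bounds telescopes.\<close>

lemma L_le_integral:
  assumes f: "f \<in> below (topspace X)"
  shows "L f \<le> integral\<^sup>L riesz_measure f"
proof -
  note fc = below_cont[OF f]
  let ?m = "measure riesz_measure" and ?I = "integral\<^sup>L riesz_measure"
  have "L f - ?I f \<le> total / real n" if n: "0 < n" for n :: nat
  proof -
    define s where "s k = (\<lambda>x. min (f x) (real k / real n))" for k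
    define a where "a k = ?m {x \<in> topspace X. real k / real n < f x}" for k
    define b where "b k = L (s k) - ?I (s k)" for k
    have sc: "continuous_map X euclideanreal (s k)" for k
      unfolding s_def using fc by (intro continuous_intros) auto
    have step: "b (Suc k) - b k \<le> (a k - a (Suc k)) / n" for k
    proof -
      define d where "d = (\<lambda>x. s (Suc k) x - s k x)"
      have dc: "continuous_map X euclideanreal d"
        unfolding d_def using sc by (intro continuous_intros) auto
      have "continuous_map X euclideanreal (\<lambda>x. real n * d x)"
        using dc by (rule continuous_map_real_mult_left)
      then have "(\<lambda>x. real n * d x) \<in> below {x \<in> topspace X. real k / real n < f x}"
        using n by (auto simp: below_def d_def s_def min_def field_simps)
      from le_measure_riesz[OF this superlevel_open[OF fc]]
      have "L d \<le> a k / n"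
        using n dc by (simp add: scale a_def field_simps)
      moreover have "a (Suc k) / n \<le> ?I d"
      proof -
        let ?V = "{x \<in> topspace X. real (Suc k) / real n < f x}"
        have V: "?V \<in> sets riesz_measure"
          unfolding sets_riesz_measure by (intro openin_sets_borel_of superlevel_open fc)
        have "a (Suc k) / n = ?I (\<lambda>x. indicator ?V x / n)"
          using V by (simp add: a_def)
        also have "\<dots> \<le> ?I d"
        proof (rule integral_mono)
          show "integrable riesz_measure (\<lambda>x. indicator ?V x / real n)"
            using V by (intro integrable_divide integrable_real_indicator)
              (auto simp: less_top[symmetric])
          show "integrable riesz_measure d" by (rule integrable_riesz[OF dc])
          show "indicator ?V x / real n \<le> d x" if "x \<in> space riesz_measure" for x
            using n by (auto simp: indicator_def d_def s_def min_def field_simps)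
        qed
        finally show ?thesis .
      qed
      moreover have "b (Suc k) - b k = L d - ?I d"
        unfolding b_def d_def using sc by (simp add: L_diff integrable_riesz)
      ultimately show ?thesis by (simp add: diff_divide_distrib)
    qed
    have "L f - ?I f = b n"
    proof -
      have "s n x = f x" if "x \<in> topspace X" for x
        using n below_le_1[OF f that] by (simp add: s_def)
      then have "L (s n) = L f" "?I (s n) = ?I f"
        using L_cong[OF sc fc] by (auto simp: space_riesz_measure intro!: Bochner_Integration.integral_cong)
      then show ?thesis by (simp add: b_def)
    qed
    also have "\<dots> = b n - b 0"
    proof -
      have "s 0 x = 0" if "x \<in> topspace X" for x
        using below_nonneg[OF f that] by (simp add: s_def)
      then have "L (s 0) = L (\<lambda>_. 0)" and "?I (s 0) = 0"
        using L_cong[OF sc, of "\<lambda>_. 0" 0] by (auto simp: space_riesz_measure intro!: integral_eq_zero_AE AE_I2)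
      then have "b 0 = 0" by (simp add: b_def L_zero)
      then show ?thesis by simp
    qed
    also have "\<dots> = (\<Sum>k<n. b (Suc k) - b k)"
      by (simp add: sum_lessThan_telescope)
    also have "\<dots> \<le> (\<Sum>k<n. (a k - a (Suc k)) / n)"
      by (intro sum_mono step)
    also have "\<dots> = (a 0 - a n) / n"
      by (simp add: sum_lessThan_telescope' flip: sum_divide_distrib)
    also have "\<dots> \<le> total / n"
    proof -
      have "a 0 \<le> total"
        unfolding a_def measure_riesz_topspace[symmetric]
        by (intro riesz.finite_measure_mono) (auto simp: sets_riesz_measure openin_sets_borel_of)
      moreover have "0 \<le> a n" by (simp add: a_def)
      ultimately show ?thesis by (intro divide_right_mono) auto
    qed
    finally show ?thesis .
  qed
  then have "\<forall>\<^sub>F n in sequentially. L f - ?I f \<le> total / real n"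
    by (intro eventually_sequentiallyI[of 1]) simp
  moreover have "(\<lambda>n. total / real n) \<longlonglongrightarrow> 0"
    by (rule lim_const_over_n)
  ultimately have "L f - ?I f \<le> 0"
    by (intro tendsto_lowerbound[of _ 0 sequentially]) auto
  then show ?thesis by simp
qed

text \<open>An affine change moves \<open>f\<close> into \<open>[0, 1]\<close>, where the inequality for \<open>f\<close> and for \<open>1 - f\<close>
  gives equality.\<close>

lemma L_eq_integral:
  assumes fc: "continuous_map X euclideanreal f"
  shows "L f = integral\<^sup>L riesz_measure f"
proof -
  let ?I = "integral\<^sup>L riesz_measure"
  obtain B where B: "0 < B" "\<And>x. x \<in> topspace X \<Longrightarrow> \<bar>f x\<bar> \<le> B"
    using continuous_map_bounded[OF compact fc] by auto
  define g where "g = (\<lambda>x. (1 / (2 * B)) * (f x + B))"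
  have I1: "?I (\<lambda>_. 1) = total"
    by (simp add: space_riesz_measure measure_riesz_topspace)
  have g01: "0 \<le> g x" "g x \<le> 1" if "x \<in> topspace X" for x
    using B(1) B(2)[OF that] by (auto simp: g_def field_simps)
  have gc: "continuous_map X euclideanreal g"
    unfolding g_def using fc by (intro continuous_intros) auto
  have "g \<in> below (topspace X)" "(\<lambda>x. 1 - g x) \<in> below (topspace X)"
    using g01 gc by (auto simp: below_def intro!: continuous_intros)
  from this[THEN L_le_integral] have "L g = ?I g"
    using gc I1 by (simp add: L_diff integrable_riesz)
  moreover have "L g = (1 / (2 * B)) * (L f + B * total)"
    unfolding g_def using fc
    by (subst scale) (auto simp: add L_const[of B] intro!: continuous_intros)
  moreover have "?I g = (1 / (2 * B)) * (?I f + B * total)"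
    unfolding g_def using integrable_riesz[OF fc] by (simp add: space_riesz_measure measure_riesz_topspace)
  ultimately show ?thesis using B(1) by simp
qed

lemma riesz_measure_in_Prob:
  assumes "total = 1" shows "riesz_measure \<in> Prob X"
  unfolding Prob_def
proof (intro CollectI conjI ballI)
  show "prob_space riesz_measure"
    by (rule prob_spaceI) (simp add: space_riesz_measure emeasure_riesz_topspace assms)
qed (auto simp: sets_riesz_measure intro: riesz_measure_inner_regular)

end

section \<open>Radon probability measures\<close>

lemma Prob_D:
  assumes "\<nu> \<in> Prob X"
  shows "prob_space \<nu>" "finite_measure \<nu>" "sets \<nu> = sets (borel_of X)" "space \<nu> = topspace X"
    and "\<And>A. A \<in> sets (borel_of X) \<Longrightarrow>
      emeasure \<nu> A = (SUP K\<in>{K. compactin X K \<and> K \<subseteq> A}. emeasure \<nu> K)"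
  using assms sets_eq_imp_space_eq[of \<nu> "borel_of X"]
  by (auto simp: Prob_def prob_space.finite_measure)

lemma Prob_integrable:
  fixes f :: "'x \<Rightarrow> 'b::{banach, second_countable_topology}"
  assumes "\<nu> \<in> Prob X" "compact_space X" "continuous_map X euclidean f"
  shows "integrable \<nu> f"
  using continuous_map_integrable[OF Prob_D(2,3)[OF assms(1)] assms(2,3)] .

text \<open>The measure of an open set is determined by the integrals of continuous functions: approximate by compact
  subsets from inside and interpolate with Urysohn functions.\<close>

lemma Prob_open_le:
  assumes X: "compact_space X" "Hausdorff_space X"
    and \<mu>: "\<mu> \<in> Prob X" and \<nu>: "\<nu> \<in> Prob X"
    and eq: "\<And>f :: 'x \<Rightarrow> real. continuous_map X euclideanreal f \<Longrightarrow> integral\<^sup>L \<mu> f = integral\<^sup>L \<nu> f"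
    and U: "openin X U"
  shows "emeasure \<mu> U \<le> emeasure \<nu> U"
  unfolding Prob_D(5)[OF \<mu> openin_sets_borel_of[OF U]]
proof (rule SUP_least, clarify)
  fix K assume K: "compactin X K" "K \<subseteq> U"
  interpret m: prob_space \<mu> by (rule Prob_D(1)[OF \<mu>])
  interpret n: prob_space \<nu> by (rule Prob_D(1)[OF \<nu>])
  have Kc: "closedin X K" using K X compactin_imp_closedin by blast
  obtain h :: "'x \<Rightarrow> real" where hc: "continuous_map X euclideanreal h"
    and h01: "\<And>x. x \<in> topspace X \<Longrightarrow> 0 \<le> h x \<and> h x \<le> 1"
    and h0: "\<And>x. x \<in> topspace X - U \<Longrightarrow> h x = 0" and h1: "\<And>x. x \<in> K \<Longrightarrow> h x = 1"
    by (rule urysohn[OF X Kc U K(2)]) blast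
  have Ks: "K \<in> sets \<mu>" using Kc Prob_D(3)[OF \<mu>] closedin_sets_borel_of by blast
  have Us: "U \<in> sets \<nu>" using U Prob_D(3)[OF \<nu>] openin_sets_borel_of by blast
  have "measure \<mu> K = integral\<^sup>L \<mu> (indicator K)" using Ks by simp
  also have "\<dots> \<le> integral\<^sup>L \<mu> h"
  proof (rule integral_mono)
    show "integrable \<mu> (indicat_real K)"
      using Ks by (intro integrable_real_indicator) (auto simp: less_top[symmetric])
    show "integrable \<mu> h" by (rule Prob_integrable[OF \<mu> X(1) hc])
    show "indicator K x \<le> h x" if "x \<in> space \<mu>" for x
      using that h01 h1 Prob_D(4)[OF \<mu>] by (auto simp: indicator_def)
  qed
  also have "\<dots> = integral\<^sup>L \<nu> h" by (rule eq[OF hc])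
  also have "\<dots> \<le> integral\<^sup>L \<nu> (indicator U)"
  proof (rule integral_mono)
    show "integrable \<nu> (indicat_real U)"
      using Us by (intro integrable_real_indicator) (auto simp: less_top[symmetric])
    show "integrable \<nu> h" by (rule Prob_integrable[OF \<nu> X(1) hc])
    show "h x \<le> indicator U x" if "x \<in> space \<nu>" for x
      using that h01 h0 Prob_D(4)[OF \<nu>] by (auto simp: indicator_def)
  qed
  also have "\<dots> = measure \<nu> U" using Us by simp
  finally show "emeasure \<mu> K \<le> emeasure \<nu> U"
    by (simp add: m.emeasure_eq_measure n.emeasure_eq_measure)
qed

text \<open>Uniqueness in the Riesz representation theorem.\<close>

lemma Prob_eqI:
  assumes X: "compact_space X" "Hausdorff_space X"
    and \<mu>: "\<mu> \<in> Prob X" and \<nu>: "\<nu> \<in> Prob X"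
    and eq: "\<And>f :: 'x \<Rightarrow> real. continuous_map X euclideanreal f \<Longrightarrow> integral\<^sup>L \<mu> f = integral\<^sup>L \<nu> f"
  shows "\<mu> = \<nu>"
proof (rule measure_eqI_generator_eq)
  interpret m: prob_space \<mu> by (rule Prob_D(1)[OF \<mu>])
  show "Int_stable {U. openin X U}" by (auto simp: Int_stable_def)
  show "{U. openin X U} \<subseteq> Pow (topspace X)" by (auto dest: openin_subset)
  show "emeasure \<mu> U = emeasure \<nu> U" if "U \<in> {U. openin X U}" for U
    using that Prob_open_le[OF X \<mu> \<nu> eq, of U] Prob_open_le[OF X \<nu> \<mu> eq[symmetric], of U]
    by (simp add: order_antisym)
  show "sets \<mu> = sigma_sets (topspace X) {U. openin X U}"
    "sets \<nu> = sigma_sets (topspace X) {U. openin X U}"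
    using Prob_D(3)[OF \<mu>] Prob_D(3)[OF \<nu>] by (simp_all add: sets_borel_of)
  show "range (\<lambda>_::nat. topspace X) \<subseteq> {U. openin X U}" by auto
  show "emeasure \<mu> (topspace X) \<noteq> \<infinity>" by simp
qed simp

lemma measurable_continuous_map:
  assumes "sets M = sets (borel_of X)" "continuous_map X Y p"
  shows "p \<in> measurable M (borel_of Y)"
  unfolding borel_of_def
proof (rule measurable_measure_of)
  have sp: "space M = topspace X" using sets_eq_imp_space_eq[OF assms(1)] by simp
  show "{U. openin Y U} \<subseteq> Pow (topspace Y)" by (auto dest: openin_subset)
  show "p \<in> space M \<rightarrow> topspace Y" using assms(2) by (auto simp: sp continuous_map_def)
  show "p -` U \<inter> space M \<in> sets M" if "U \<in> {U. openin Y U}" for U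
  proof -
    have "p -` U \<inter> space M = {x \<in> topspace X. p x \<in> U}" by (auto simp: sp)
    then show ?thesis
      using openin_continuous_map_preimage[OF assms(2), of U] that assms(1)
      by (simp add: openin_sets_borel_of)
  qed
qed

lemma Prob_distr:
  assumes H: "Hausdorff_space X" and \<nu>: "\<nu> \<in> Prob X" and p: "continuous_map X X p"
  shows "distr \<nu> (borel_of X) p \<in> Prob X"
proof -
  note sp = Prob_D(4)[OF \<nu>]
  have m: "p \<in> measurable \<nu> (borel_of X)"
    by (rule measurable_continuous_map[OF Prob_D(3)[OF \<nu>] p])
  have K: "K \<in> sets (borel_of X)" if "compactin X K" for K
    using that H compactin_imp_closedin closedin_sets_borel_of by blast
  have "emeasure (distr \<nu> (borel_of X) p) A =
    (SUP K\<in>{K. compactin X K \<and> K \<subseteq> A}. emeasure (distr \<nu> (borel_of X) p) K)"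
    if A: "A \<in> sets (borel_of X)" for A
  proof (rule antisym)
    have "p -` A \<inter> topspace X \<in> sets (borel_of X)"
      using measurable_sets[OF m A] by (simp add: sp Prob_D(3)[OF \<nu>])
    then have "emeasure (distr \<nu> (borel_of X) p) A =
        (SUP K\<in>{K. compactin X K \<and> K \<subseteq> p -` A \<inter> topspace X}. emeasure \<nu> K)"
      using A m by (simp add: emeasure_distr sp Prob_D(5)[OF \<nu>])
    also have "\<dots> \<le> (SUP K\<in>{K. compactin X K \<and> K \<subseteq> A}. emeasure (distr \<nu> (borel_of X) p) K)"
    proof (rule SUP_mono, clarify)
      fix C assume C: "compactin X C" "C \<subseteq> p -` A \<inter> topspace X"
      have pC: "compactin X (p ` C)" by (rule image_compactin[OF C(1) p])
      have "emeasure \<nu> C \<le> emeasure \<nu> (p -` (p ` C) \<inter> space \<nu>)"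
        using C measurable_sets[OF m K[OF pC]] by (intro emeasure_mono) (auto simp: sp)
      also have "\<dots> = emeasure (distr \<nu> (borel_of X) p) (p ` C)"
        using m K[OF pC] by (simp add: emeasure_distr)
      finally show "\<exists>K\<in>{K. compactin X K \<and> K \<subseteq> A}. emeasure \<nu> C \<le> emeasure (distr \<nu> (borel_of X) p) K"
        using pC C by (intro bexI[of _ "p ` C"]) auto
    qed
    finally show "emeasure (distr \<nu> (borel_of X) p) A
      \<le> (SUP K\<in>{K. compactin X K \<and> K \<subseteq> A}. emeasure (distr \<nu> (borel_of X) p) K)" .
    show "(SUP K\<in>{K. compactin X K \<and> K \<subseteq> A}. emeasure (distr \<nu> (borel_of X) p) K)
      \<le> emeasure (distr \<nu> (borel_of X) p) A"
      using A by (intro SUP_least emeasure_mono) auto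
  qed
  then show ?thesis
    using prob_space.prob_space_distr[OF Prob_D(1)[OF \<nu>] m] by (simp add: Prob_def)
qed

lemma return_in_Prob:
  assumes x: "x \<in> topspace X" and "Hausdorff_space X"
  shows "return (borel_of X) x \<in> Prob X"
  unfolding Prob_def
proof (intro CollectI conjI ballI)
  let ?d = "return (borel_of X) x"
  show "prob_space ?d" using x by (intro prob_space_return) simp
  fix A assume A: "A \<in> sets ?d"
  have K: "K \<in> sets (borel_of X)" if "compactin X K" for K
    using that assms compactin_imp_closedin closedin_sets_borel_of by blast
  show "emeasure ?d A = (SUP K\<in>{K. compactin X K \<and> K \<subseteq> A}. emeasure ?d K)"
  proof (rule antisym)
    show "(SUP K\<in>{K. compactin X K \<and> K \<subseteq> A}. emeasure ?d K) \<le> emeasure ?d A"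
      using A by (intro SUP_least emeasure_mono) auto
    show "emeasure ?d A \<le> (SUP K\<in>{K. compactin X K \<and> K \<subseteq> A}. emeasure ?d K)"
    proof (cases "x \<in> A")
      case True
      have "compactin X {x}" using x by simp
      with True A K[OF this] show ?thesis
        by (intro SUP_upper2[of "{x}"]) auto
    qed (use A in auto)
  qed
qed auto

lemma integral_return_borel_of:
  fixes f :: "'x \<Rightarrow> 'b::{banach, second_countable_topology}"
  assumes "x \<in> topspace X" "continuous_map X euclidean f"
  shows "integral\<^sup>L (return (borel_of X) x) f = f x"
  using assms continuous_map_measurable[OF refl assms(2)] by (simp add: integral_return)

section \<open>The weak-star topology\<close>

lemma topspace_weak_star: "topspace (weak_star X) = Prob X"
  by (auto simp: weak_star_def topspace_pullback_topology)

lemma C_carrier_D: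
  assumes "f \<in> C_carrier X"
  shows "continuous_map X euclidean f" "\<And>x. x \<notin> topspace X \<Longrightarrow> f x = 0"
  using assms by (auto simp: C_carrier_def)

lemma weak_star_openin_ball:
  fixes X :: "'x topology"
  assumes "f \<in> C_carrier X"
  shows "openin (weak_star X) {\<mu> \<in> Prob X. cmod (integral\<^sup>L \<mu> f - c) < e}"
proof -
  let ?P = "product_topology (\<lambda>_. euclidean) (C_carrier X) :: (('x \<Rightarrow> complex) \<Rightarrow> complex) topology"
  have "openin ?P {u \<in> topspace ?P. u f \<in> ball c e}"
    using assms by (intro openin_continuous_map_preimage[OF continuous_map_product_projection]) auto
  moreover have "{\<mu> \<in> Prob X. cmod (integral\<^sup>L \<mu> f - c) < e} =
    (\<lambda>\<mu>. \<lambda>f\<in>C_carrier X. integral\<^sup>L \<mu> f) -` {u \<in> topspace ?P. u f \<in> ball c e} \<inter> Prob X"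
    using assms by (auto simp: dist_norm norm_minus_commute)
  ultimately show ?thesis
    unfolding weak_star_def openin_pullback_topology by blast
qed

lemma weak_star_neighbourhood:
  fixes X :: "'x topology"
  assumes "openin (weak_star X) T" "\<mu> \<in> T"
  obtains F e where "finite F" "F \<subseteq> C_carrier X" "0 < e"
    "\<And>\<nu>. \<nu> \<in> Prob X \<Longrightarrow> (\<And>f. f \<in> F \<Longrightarrow> cmod (integral\<^sup>L \<nu> f - integral\<^sup>L \<mu> f) < e) \<Longrightarrow> \<nu> \<in> T"
proof -
  let ?P = "product_topology (\<lambda>_. euclidean) (C_carrier X) :: (('x \<Rightarrow> complex) \<Rightarrow> complex) topology"
  let ?I = "\<lambda>\<mu>. \<lambda>f\<in>C_carrier X. integral\<^sup>L \<mu> f"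
  obtain U where U: "openin ?P U" "T = ?I -` U \<inter> Prob X"
    using assms(1) unfolding weak_star_def openin_pullback_topology by blast
  then have "?I \<mu> \<in> U" using assms(2) by blast
  from product_topology_open_contains_basis[OF U(1) this]
  obtain V where V: "?I \<mu> \<in> (\<Pi>\<^sub>E f\<in>C_carrier X. V f)" "\<And>f. open (V f)"
    "finite {f. V f \<noteq> UNIV}" "(\<Pi>\<^sub>E f\<in>C_carrier X. V f) \<subseteq> U"
    by auto
  define F where "F = {f \<in> C_carrier X. V f \<noteq> UNIV}"
  have "\<exists>e>0. \<forall>z. dist z (integral\<^sup>L \<mu> f) < e \<longrightarrow> z \<in> V f" if "f \<in> F" for f
    using V(1) V(2)[of f] that by (auto simp: F_def PiE_iff open_dist)
  then obtain r where r: "\<And>f. f \<in> F \<Longrightarrow> 0 < r f"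
    "\<And>f z. f \<in> F \<Longrightarrow> dist z (integral\<^sup>L \<mu> f) < r f \<Longrightarrow> z \<in> V f"
    by metis
  have fin: "finite F" using V(3) by (auto simp: F_def)
  define e where "e = Min (insert 1 (r ` F))"
  have e: "0 < e" "\<And>f. f \<in> F \<Longrightarrow> e \<le> r f"
    using fin r(1) by (auto simp: e_def)
  show ?thesis
  proof (rule that[OF fin _ e(1)])
    show "F \<subseteq> C_carrier X" by (auto simp: F_def)
    fix \<nu> assume \<nu>: "\<nu> \<in> Prob X" "\<And>f. f \<in> F \<Longrightarrow> cmod (integral\<^sup>L \<nu> f - integral\<^sup>L \<mu> f) < e"
    have "integral\<^sup>L \<nu> f \<in> V f" if "f \<in> C_carrier X" for f
    proof (cases "f \<in> F")
      case True
      then show ?thesis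
        using \<nu>(2)[OF True] e(2)[OF True] by (intro r(2)) (auto simp: dist_norm)
    qed (use that in \<open>auto simp: F_def\<close>)
    then have "?I \<nu> \<in> (\<Pi>\<^sub>E f\<in>C_carrier X. V f)" by auto
    with V(4) U(2) \<nu>(1) show "\<nu> \<in> T" by blast
  qed
qed

section \<open>Operators on sequence spaces\<close>

lemma ell2_D:
  assumes "\<xi> \<in> ell2 I"
  shows "(\<lambda>i. (cmod (\<xi> i))\<^sup>2) summable_on I" "\<And>i. i \<notin> I \<Longrightarrow> \<xi> i = 0"
  using assms by (auto simp: ell2_def)

lemma ell2_dominated:
  assumes "\<xi> \<in> ell2 I" and "\<And>i. i \<notin> I \<Longrightarrow> \<eta> i = 0"
    and "\<And>i. i \<in> I \<Longrightarrow> cmod (\<eta> i) \<le> K * cmod (\<xi> i)"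
  shows "\<eta> \<in> ell2 I"
proof -
  have "(\<lambda>i. K\<^sup>2 * (cmod (\<xi> i))\<^sup>2) summable_on I"
    by (intro summable_on_cmult_right ell2_D assms)
  moreover have "(cmod (\<eta> i))\<^sup>2 \<le> K\<^sup>2 * (cmod (\<xi> i))\<^sup>2" if "i \<in> I" for i
    using power_mono[OF assms(3)[OF that], of 2] by (simp add: power_mult_distrib)
  ultimately have "(\<lambda>i. (cmod (\<eta> i))\<^sup>2) summable_on I"
    by (rule summable_on_comparison_test) auto
  then show ?thesis using assms(2) by (simp add: ell2_def)
qed

lemma ell2_zero: "(\<lambda>_. 0) \<in> ell2 I"
  by (simp add: ell2_def)

lemma ell2_scale: "\<xi> \<in> ell2 I \<Longrightarrow> (\<lambda>i. a * \<xi> i) \<in> ell2 I"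
  by (rule ell2_dominated[where K = "cmod a"]) (auto simp: ell2_D norm_mult)

lemma ell2_add:
  assumes "\<xi> \<in> ell2 I" "\<eta> \<in> ell2 I"
  shows "(\<lambda>i. \<xi> i + \<eta> i) \<in> ell2 I"
proof -
  have "(\<lambda>i. 2 * (cmod (\<xi> i))\<^sup>2 + 2 * (cmod (\<eta> i))\<^sup>2) summable_on I"
    by (intro summable_on_add summable_on_cmult_right ell2_D assms)
  moreover have "(cmod (\<xi> i + \<eta> i))\<^sup>2 \<le> 2 * (cmod (\<xi> i))\<^sup>2 + 2 * (cmod (\<eta> i))\<^sup>2" for i
  proof -
    have "(cmod (\<xi> i + \<eta> i))\<^sup>2 \<le> (cmod (\<xi> i) + cmod (\<eta> i))\<^sup>2"
      by (intro power_mono norm_triangle_ineq) auto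
    also have "\<dots> \<le> 2 * (cmod (\<xi> i))\<^sup>2 + 2 * (cmod (\<eta> i))\<^sup>2"
      using zero_le_power2[of "cmod (\<xi> i) - cmod (\<eta> i)"] by (simp add: power2_eq_square algebra_simps)
    finally show ?thesis .
  qed
  ultimately have "(\<lambda>i. (cmod (\<xi> i + \<eta> i))\<^sup>2) summable_on I"
    by (rule summable_on_comparison_test) auto
  then show ?thesis using assms by (simp add: ell2_def)
qed

lemma ell2_inner_summable:
  assumes "\<xi> \<in> ell2 I" "\<eta> \<in> ell2 I"
  shows "(\<lambda>i. \<xi> i * cnj (\<eta> i)) summable_on I"
proof -
  have "(\<lambda>i. (cmod (\<xi> i))\<^sup>2 + (cmod (\<eta> i))\<^sup>2) summable_on I"
    by (intro summable_on_add ell2_D assms)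
  moreover have "norm (\<xi> i * cnj (\<eta> i)) \<le> (cmod (\<xi> i))\<^sup>2 + (cmod (\<eta> i))\<^sup>2" for i
  proof -
    have "0 \<le> cmod (\<xi> i) * cmod (\<eta> i)" by simp
    then show ?thesis
      using zero_le_power2[of "cmod (\<xi> i) - cmod (\<eta> i)"]
      unfolding norm_mult complex_mod_cnj power2_diff by linarith
  qed
  ultimately have "(\<lambda>i. norm (\<xi> i * cnj (\<eta> i))) summable_on I"
    by (rule summable_on_comparison_test) auto
  then show ?thesis by (rule abs_summable_summable)
qed

lemma ell2_norm_nonneg: "0 \<le> ell2_norm I \<xi>"
  by (simp add: ell2_norm_def infsum_nonneg)

lemma ell2_norm_power2: "(ell2_norm I \<xi>)\<^sup>2 = (\<Sum>\<^sub>\<infinity>i\<in>I. (cmod (\<xi> i))\<^sup>2)"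
  by (simp add: ell2_norm_def infsum_nonneg)

lemma ell2_inner_self:
  assumes "\<xi> \<in> ell2 I" shows "ell2_inner I \<xi> \<xi> = of_real ((ell2_norm I \<xi>)\<^sup>2)"
proof -
  have "ell2_inner I \<xi> \<xi> = (\<Sum>\<^sub>\<infinity>i\<in>I. complex_of_real ((cmod (\<xi> i))\<^sup>2))"
    unfolding ell2_inner_def by (intro infsum_cong) (simp only: complex_norm_square)
  also have "\<dots> = of_real (\<Sum>\<^sub>\<infinity>i\<in>I. (cmod (\<xi> i))\<^sup>2)"
    by (intro infsumI has_sum_of_real has_sum_infsum ell2_D assms)
  finally show ?thesis by (simp only: ell2_norm_power2)
qed

lemma ell2_inner_scale_left: "ell2_inner I (\<lambda>i. a * \<xi> i) \<eta> = a * ell2_inner I \<xi> \<eta>"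
  by (simp add: ell2_inner_def mult.assoc infsum_cmult_right')

lemma ell2_inner_scale_right: "ell2_inner I \<xi> (\<lambda>i. a * \<eta> i) = cnj a * ell2_inner I \<xi> \<eta>"
  by (simp add: ell2_inner_def mult.left_commute[of _ "cnj a"] infsum_cmult_right')

lemma ell2_inner_delta:
  assumes "c \<in> I" shows "ell2_inner I \<xi> (ell2_delta c) = \<xi> c"
proof -
  have "ell2_inner I \<xi> (ell2_delta c) = (\<Sum>\<^sub>\<infinity>i\<in>{c}. \<xi> i)"
    unfolding ell2_inner_def
    by (rule infsum_cong_neutral) (use assms in \<open>auto simp: ell2_delta_def\<close>)
  then show ?thesis by simp
qed

lemma ell2_norm_delta:
  assumes "c \<in> I" shows "ell2_norm I (ell2_delta c) = 1"
proof -
  have "complex_of_real ((ell2_norm I (ell2_delta c))\<^sup>2) = 1"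
    using ell2_inner_self[OF ell2_delta_in_ell2[OF assms]] ell2_inner_delta[OF assms, of "ell2_delta c"]
    by (simp add: ell2_delta_def)
  then have "(ell2_norm I (ell2_delta c))\<^sup>2 = 1" by (metis of_real_eq_1_iff)
  then show ?thesis using ell2_norm_nonneg[of I "ell2_delta c"] by (simp add: power2_eq_1_iff)
qed

lemma ell2_norm_zero: "ell2_norm I (\<lambda>_. 0) = 0"
  by (simp add: ell2_norm_def)

lemma ell2_coordinate_le:
  assumes "\<xi> \<in> ell2 I" "c \<in> I" shows "cmod (\<xi> c) \<le> ell2_norm I \<xi>"
proof -
  have "(cmod (\<xi> c))\<^sup>2 \<le> (ell2_norm I \<xi>)\<^sup>2"
    using finite_sum_le_infsum[OF ell2_D(1)[OF assms(1)], of "{c}"] assms(2)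
    by (simp add: ell2_norm_power2)
  then show ?thesis by (rule power2_le_imp_le[OF _ ell2_norm_nonneg])
qed

lemma B_carrier_D:
  assumes "T \<in> B_carrier I"
  shows "\<And>\<xi>. \<xi> \<in> ell2 I \<Longrightarrow> T \<xi> \<in> ell2 I"
    "\<And>\<xi>. \<xi> \<notin> ell2 I \<Longrightarrow> T \<xi> = (\<lambda>i. 0)"
    "\<And>a \<xi>. \<xi> \<in> ell2 I \<Longrightarrow> T (\<lambda>i. a * \<xi> i) = (\<lambda>i. a * T \<xi> i)"
    "\<exists>K. \<forall>\<xi>\<in>ell2 I. ell2_norm I (T \<xi>) \<le> K * ell2_norm I \<xi>"
  using assms by (auto simp: B_carrier_def)

lemma op_norm_upper:
  assumes T: "T \<in> B_carrier I" and "\<xi> \<in> ell2 I" "ell2_norm I \<xi> \<le> 1"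
  shows "ell2_norm I (T \<xi>) \<le> os_norm (B_system I) T"
proof -
  obtain K where K: "\<And>\<zeta>. \<zeta> \<in> ell2 I \<Longrightarrow> ell2_norm I (T \<zeta>) \<le> K * ell2_norm I \<zeta>"
    using B_carrier_D(4)[OF T] by blast
  have "ell2_norm I (T \<zeta>) \<le> \<bar>K\<bar>" if "\<zeta> \<in> ell2 I" "ell2_norm I \<zeta> \<le> 1" for \<zeta>
  proof -
    have "K * ell2_norm I \<zeta> \<le> \<bar>K\<bar> * 1"
      using that ell2_norm_nonneg by (intro mult_mono) auto
    then show ?thesis using K[OF that(1)] by simp
  qed
  then show ?thesis
    unfolding B_system_def op_system.simps
    using assms(2,3) by (intro cSUP_upper bdd_aboveI2[where M = "\<bar>K\<bar>"]) auto
qed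

lemma op_norm_least:
  assumes "\<And>\<xi>. \<xi> \<in> ell2 I \<Longrightarrow> ell2_norm I (T \<xi>) \<le> K * ell2_norm I \<xi>" and "0 \<le> K"
  shows "os_norm (B_system I) T \<le> K"
  unfolding B_system_def op_system.simps
proof (rule cSUP_least)
  show "{\<xi> \<in> ell2 I. ell2_norm I \<xi> \<le> 1} \<noteq> {}"
    using ell2_zero[of I] ell2_norm_zero[of I] by force
  fix \<xi> assume "\<xi> \<in> {\<xi> \<in> ell2 I. ell2_norm I \<xi> \<le> 1}"
  then have "ell2_norm I (T \<xi>) \<le> K * ell2_norm I \<xi>" "K * ell2_norm I \<xi> \<le> K * 1"
    using assms(1) mult_left_mono[OF _ assms(2), of "ell2_norm I \<xi>" 1] by auto
  then show "ell2_norm I (T \<xi>) \<le> K" by simp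
qed

lemma op_norm_diagonal_entry:
  assumes "T \<in> B_carrier I" "c \<in> I"
  shows "cmod (T (ell2_delta c) c) \<le> os_norm (B_system I) T"
proof -
  have d: "ell2_delta c \<in> ell2 I" by (rule ell2_delta_in_ell2[OF assms(2)])
  have "cmod (T (ell2_delta c) c) \<le> ell2_norm I (T (ell2_delta c))"
    by (rule ell2_coordinate_le[OF B_carrier_D(1)[OF assms(1) d] assms(2)])
  also have "\<dots> \<le> os_norm (B_system I) T"
    using op_norm_upper[OF assms(1) d] ell2_norm_delta[OF assms(2)] by simp
  finally show ?thesis .
qed

text \<open>The multiplication operator by the function \<open>m\<close>, normalised to vanish outside \<open>\<ell>\<^sup>2(I)\<close>.\<close>

definition diag_op :: "'i set \<Rightarrow> ('i \<Rightarrow> complex) \<Rightarrow> ('i \<Rightarrow> complex) \<Rightarrow> 'i \<Rightarrow> complex" where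
  "diag_op I m \<xi> = (if \<xi> \<in> ell2 I then (\<lambda>i. m i * \<xi> i) else (\<lambda>_. 0))"

lemma diag_op_cong:
  assumes "\<And>c. c \<in> I \<Longrightarrow> m c = m' c" shows "diag_op I m = diag_op I m'"
proof (intro ext)
  fix \<xi> c show "diag_op I m \<xi> c = diag_op I m' \<xi> c"
    using assms ell2_D(2)[of \<xi> I c] by (cases "c \<in> I") (auto simp: diag_op_def)
qed

lemma diag_op_bounded:
  assumes m: "\<And>i. i \<in> I \<Longrightarrow> cmod (m i) \<le> K" and "0 \<le> K"
  shows "diag_op I m \<in> B_carrier I"
    and "\<And>\<xi>. \<xi> \<in> ell2 I \<Longrightarrow> ell2_norm I (diag_op I m \<xi>) \<le> K * ell2_norm I \<xi>"
proof -
  have le: "cmod (m i * \<xi> i) \<le> K * cmod (\<xi> i)" if "i \<in> I" for \<xi> i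
    using m[OF that] by (simp add: norm_mult mult_right_mono)
  have mem: "(\<lambda>i. m i * \<xi> i) \<in> ell2 I" if "\<xi> \<in> ell2 I" for \<xi>
    using that by (rule ell2_dominated[where K = K]) (auto simp: ell2_D(2)[OF that] intro: le)
  show nrm: "ell2_norm I (diag_op I m \<xi>) \<le> K * ell2_norm I \<xi>" if \<xi>: "\<xi> \<in> ell2 I" for \<xi>
  proof (rule power2_le_imp_le)
    have "(\<Sum>\<^sub>\<infinity>i\<in>I. (cmod (m i * \<xi> i))\<^sup>2) \<le> (\<Sum>\<^sub>\<infinity>i\<in>I. K\<^sup>2 * (cmod (\<xi> i))\<^sup>2)"
    proof (rule infsum_mono)
      show "(cmod (m i * \<xi> i))\<^sup>2 \<le> K\<^sup>2 * (cmod (\<xi> i))\<^sup>2" if "i \<in> I" for i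
        using power_mono[OF le[OF that, of \<xi>], of 2] by (simp add: power_mult_distrib)
    qed (auto intro!: ell2_D(1)[OF mem[OF \<xi>]] summable_on_cmult_right ell2_D(1)[OF \<xi>])
    then show "(ell2_norm I (diag_op I m \<xi>))\<^sup>2 \<le> (K * ell2_norm I \<xi>)\<^sup>2"
      using \<xi> by (simp add: power_mult_distrib ell2_norm_power2 diag_op_def infsum_cmult_right')
    show "0 \<le> K * ell2_norm I \<xi>" using \<open>0 \<le> K\<close> by (simp add: ell2_norm_nonneg)
  qed
  show "diag_op I m \<in> B_carrier I"
    unfolding B_carrier_def
    using mem nrm by (auto simp: diag_op_def ell2_add ell2_scale algebra_simps)
qed

section \<open>Completely positive maps on continuous functions\<close>

lemma C_system_simps [simp]:
  "os_carrier (C_system X) = C_carrier X"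
  "os_add (C_system X) = (\<lambda>f h x. f x + h x)"
  "os_scale (C_system X) = (\<lambda>a f x. a * f x)"
  "os_unit (C_system X) = (\<lambda>x. if x \<in> topspace X then 1 else 0)"
  by (simp_all add: C_system_def)

lemma B_system_simps [simp]:
  "os_carrier (B_system I) = B_carrier I"
  "os_add (B_system I) = (\<lambda>S T \<xi> i. S \<xi> i + T \<xi> i)"
  "os_scale (B_system I) = (\<lambda>a T \<xi> i. a * T \<xi> i)"
  "os_unit (B_system I) = (\<lambda>\<xi>. if \<xi> \<in> ell2 I then \<xi> else (\<lambda>i. 0))"
  by (simp_all add: B_system_def)

lemma C_norm_upper:
  assumes "compact_space X" "f \<in> C_carrier X" "x \<in> topspace X"
  shows "cmod (f x) \<le> os_norm (C_system X) f"
proof -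
  obtain B where B: "0 < B" "\<And>x. x \<in> topspace X \<Longrightarrow> cmod (f x) \<le> B"
    using continuous_map_bounded[OF assms(1) C_carrier_D(1)[OF assms(2)]] by auto
  then have "bdd_above (insert 0 ((\<lambda>x. cmod (f x)) ` topspace X))"
    by (intro bdd_aboveI[where M = B]) auto
  then show ?thesis
    unfolding C_system_def op_system.simps using assms(3) by (intro cSup_upper) auto
qed

lemma C_norm_least:
  assumes "\<And>x. x \<in> topspace X \<Longrightarrow> cmod (f x) \<le> K" "0 \<le> K"
  shows "os_norm (C_system X) f \<le> K"
  unfolding C_system_def op_system.simps using assms by (intro cSup_least) auto

lemma C_norm_nonneg:
  assumes "compact_space X" "f \<in> C_carrier X"
  shows "0 \<le> os_norm (C_system X) f"
proof (cases "topspace X = {}")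
  case True
  then show ?thesis by (simp add: C_system_def)
next
  case False
  then obtain x where "x \<in> topspace X" by blast
  then show ?thesis
    using C_norm_upper[OF assms, of x] norm_ge_zero[of "f x"] by linarith
qed

lemma continuous_map_C_D:
  assumes "f \<in> C_carrier X"
  shows "continuous_map X euclideanreal (\<lambda>x. Re (f x))" "continuous_map X euclideanreal (\<lambda>x. Im (f x))"
    "continuous_map X euclideanreal (\<lambda>x. cmod (f x - c))"
proof -
  have c: "continuous_map X euclideanreal (\<lambda>x. r (f x))" if "continuous_on UNIV r" for r :: "complex \<Rightarrow> real"
    using continuous_map_compose[OF C_carrier_D(1)[OF assms], of euclideanreal r] that
    by (simp add: o_def)
  show "continuous_map X euclideanreal (\<lambda>x. Re (f x))" "continuous_map X euclideanreal (\<lambda>x. Im (f x))"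
    "continuous_map X euclideanreal (\<lambda>x. cmod (f x - c))"
    by (rule c, intro continuous_intros)+
qed

lemma C_carrier_unit: "(\<lambda>x. if x \<in> topspace X then 1 else 0) \<in> C_carrier X"
  unfolding C_carrier_def by (auto intro: continuous_map_eq[of X euclidean "\<lambda>_. 1"])

lemma C_carrier_add: "f \<in> C_carrier X \<Longrightarrow> g \<in> C_carrier X \<Longrightarrow> (\<lambda>x. f x + g x) \<in> C_carrier X"
  by (simp add: C_carrier_def continuous_map_add)

lemma C_carrier_comp:
  assumes "f \<in> C_carrier X" "continuous_on UNIV r" "r 0 = 0"
  shows "(\<lambda>x. r (f x)) \<in> C_carrier X"
  using continuous_map_compose[OF C_carrier_D(1)[OF assms(1)], of euclidean r] assms
  by (auto simp: o_def C_carrier_def)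

lemma C_carrier_scale: "f \<in> C_carrier X \<Longrightarrow> (\<lambda>x. a * f x) \<in> C_carrier X"
  by (rule C_carrier_comp) (auto intro!: continuous_intros)

text \<open>The element of \<open>C(X)\<close> given by a real function; it has to vanish outside the space.\<close>

definition lift :: "'x topology \<Rightarrow> ('x \<Rightarrow> real) \<Rightarrow> 'x \<Rightarrow> complex" where
  "lift X f = (\<lambda>x. if x \<in> topspace X then complex_of_real (f x) else 0)"

lemma lift_in_C_carrier:
  assumes "continuous_map X euclideanreal f" shows "lift X f \<in> C_carrier X"
proof -
  have "continuous_map X euclidean (\<lambda>x. complex_of_real (f x))"
    using continuous_map_compose[OF assms, of euclidean complex_of_real]
    by (auto simp: o_def intro!: continuous_intros)
  then have "continuous_map X euclidean (lift X f)"
    by (rule continuous_map_eq) (simp add: lift_def)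
  then show ?thesis by (simp add: C_carrier_def lift_def)
qed

text \<open>Unital completely positive maps are contractive.  If \<open>|f| \<le> s\<close>, the matrix with rows \<open>(1, -f)\<close>
  and \<open>(-cnj f, s\<^sup>2)\<close> is positive, hence so is its image under \<open>\<Phi>\<close>.  Evaluating the image at the pair
  of vectors \<open>\<eta> = \<Phi> f \<xi>\<close> and \<open>\<zeta>\<close>, with \<open>\<zeta>\<close> one of \<open>\<xi>\<close> and \<open>\<i> \<xi>\<close>, gives
  \<open>\<parallel>\<eta>\<parallel>\<^sup>2 \<le> s\<^sup>2 \<parallel>\<xi>\<parallel>\<^sup>2\<close>.\<close>

lemma cp_contractive:
  assumes lin: "os_linear (C_system X) (B_system I) \<Phi>"
    and unit: "\<Phi> (os_unit (C_system X)) = os_unit (B_system I)"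
    and cp: "completely_positive (C_system X) (B_system I) \<Phi>"
    and f: "f \<in> C_carrier X" and s: "0 \<le> s" "\<And>x. x \<in> topspace X \<Longrightarrow> cmod (f x) \<le> s"
    and \<xi>: "\<xi> \<in> ell2 I"
  shows "ell2_norm I (\<Phi> f \<xi>) \<le> s * ell2_norm I \<xi>"
proof -
  define u :: "'a \<Rightarrow> complex" where "u = (\<lambda>x. if x \<in> topspace X then 1 else 0)"
  define h where "h = (\<lambda>x. cnj (f x))"
  have uC: "u \<in> C_carrier X" unfolding u_def by (rule C_carrier_unit)
  have hC: "h \<in> C_carrier X"
    unfolding h_def by (rule C_carrier_comp[OF f]) (auto intro!: continuous_intros)
  have sc: "\<Phi> (\<lambda>x. a * k x) = (\<lambda>\<zeta> i. a * \<Phi> k \<zeta> i)" if "k \<in> C_carrier X" for a k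
    using lin that by (simp add: os_linear_def)
  have \<Phi>B: "\<Phi> k \<in> B_carrier I" if "k \<in> C_carrier X" for k
    using lin that by (simp add: os_linear_def)
  have \<Phi>u: "\<Phi> u \<zeta> = \<zeta>" if "\<zeta> \<in> ell2 I" for \<zeta>
    using unit that by (simp add: u_def)
  define A :: "nat \<Rightarrow> nat \<Rightarrow> 'a \<Rightarrow> complex" where
    "A i j = (if i = 0 then if j = 0 then u else (\<lambda>x. (-1) * f x)
              else if j = 0 then (\<lambda>x. (-1) * h x) else (\<lambda>x. of_real (s\<^sup>2) * u x))" for i j
  have "A \<in> os_pos (C_system X) 2"
    unfolding C_system_def op_system.simps
  proof (intro CollectI conjI allI impI ballI)
    show "A i j \<in> C_carrier X" for i j
      unfolding A_def using uC C_carrier_scale[OF f, of "-1"] C_carrier_scale[OF hC, of "-1"] C_carrier_scale[OF uC]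
      by simp
    fix x and v :: "nat \<Rightarrow> complex" assume x: "x \<in> topspace X"
    let ?a = "v 0" and ?b = "v 1" and ?z = "f x"
    have "(\<Sum>i<2. \<Sum>j<2. cnj (v i) * A i j x * v j) =
        cnj ?a * ?a - cnj ?a * ?z * ?b - cnj ?b * cnj ?z * ?a + of_real (s\<^sup>2) * (cnj ?b * ?b)"
      using x by (simp add: numeral_2_eq_2 A_def u_def h_def)
    also have "\<dots> = (?a - ?z * ?b) * cnj (?a - ?z * ?b)
        + (of_real (s\<^sup>2) - ?z * cnj ?z) * (?b * cnj ?b)"
      by (simp add: algebra_simps)
    also have "\<dots> = of_real ((cmod (?a - ?z * ?b))\<^sup>2 + (s\<^sup>2 - (cmod ?z)\<^sup>2) * (cmod ?b)\<^sup>2)"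
      by (simp only: of_real_add of_real_mult of_real_diff complex_norm_square)
    also have "\<dots> \<in> \<real>\<^sub>\<ge>\<^sub>0"
      using power_mono[OF s(2)[OF x], of 2]
      by (subst nonneg_Reals_of_real_iff) (auto intro!: add_nonneg_nonneg mult_nonneg_nonneg)
    finally show "(\<Sum>i<2. \<Sum>j<2. cnj (v i) * A i j x * v j) \<in> \<real>\<^sub>\<ge>\<^sub>0" .
  qed
  with cp have pos: "(\<lambda>i j. \<Phi> (A i j)) \<in> os_pos (B_system I) 2"
    by (auto simp: completely_positive_def)
  define \<eta> where "\<eta> = \<Phi> f \<xi>"
  have \<eta>: "\<eta> \<in> ell2 I" unfolding \<eta>_def by (rule B_carrier_D(1)[OF \<Phi>B[OF f] \<xi>])
  define N where "N = (ell2_norm I \<eta>)\<^sup>2"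
  define M where "M = s\<^sup>2 * (ell2_norm I \<xi>)\<^sup>2"
  define Y where "Y = ell2_inner I (\<Phi> h \<eta>) \<xi>"
  have key: "of_real N - ell2_inner I (\<Phi> f \<zeta>) \<eta> - ell2_inner I (\<Phi> h \<eta>) \<zeta>
      + of_real (s\<^sup>2) * ell2_inner I \<zeta> \<zeta> \<in> \<real>\<^sub>\<ge>\<^sub>0" if \<zeta>: "\<zeta> \<in> ell2 I" for \<zeta>
  proof -
    let ?z = "\<lambda>i::nat. if i = 0 then \<eta> else \<zeta>"
    have "(\<Sum>i<2. \<Sum>j<2. ell2_inner I (\<Phi> (A i j) (?z j)) (?z i)) \<in> \<real>\<^sub>\<ge>\<^sub>0"
      using pos \<eta> \<zeta> unfolding B_system_def op_system.simps mem_Collect_eq by simp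
    also have "(\<Sum>i<2. \<Sum>j<2. ell2_inner I (\<Phi> (A i j) (?z j)) (?z i)) =
        ell2_inner I (\<Phi> u \<eta>) \<eta> + ell2_inner I (\<Phi> (\<lambda>x. (-1) * f x) \<zeta>) \<eta>
        + (ell2_inner I (\<Phi> (\<lambda>x. (-1) * h x) \<eta>) \<zeta> + ell2_inner I (\<Phi> (\<lambda>x. of_real (s\<^sup>2) * u x) \<zeta>) \<zeta>)"
      by (simp add: numeral_2_eq_2 A_def)
    also have "\<dots> = of_real N - ell2_inner I (\<Phi> f \<zeta>) \<eta> - ell2_inner I (\<Phi> h \<eta>) \<zeta>
      + of_real (s\<^sup>2) * ell2_inner I \<zeta> \<zeta>"
      unfolding sc[OF f] sc[OF hC] sc[OF uC] ell2_inner_scale_left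
      by (simp add: \<Phi>u[OF \<eta>] \<Phi>u[OF \<zeta>] ell2_inner_self[OF \<eta>] N_def)
    finally show ?thesis .
  qed
  have X1: "ell2_inner I (\<Phi> f \<xi>) \<eta> = of_real N"
    by (simp add: \<eta>_def[symmetric] ell2_inner_self[OF \<eta>] N_def)
  have X2: "ell2_inner I (\<Phi> f (\<lambda>i. \<i> * \<xi> i)) \<eta> = \<i> * of_real N"
    using X1 by (simp add: B_carrier_D(3)[OF \<Phi>B[OF f] \<xi>] ell2_inner_scale_left)
  \<comment> \<open>The case \<open>\<zeta> = \<xi>\<close>: the two copies of \<open>\<parallel>\<eta>\<parallel>\<^sup>2\<close> cancel.\<close>
  have "of_real M - Y \<in> \<real>\<^sub>\<ge>\<^sub>0"
    using key[OF \<xi>] X1 by (simp add: Y_def M_def ell2_inner_self[OF \<xi>])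
  then have Y: "Im Y = 0" "Re Y \<le> M" by (auto simp: complex_nonneg_Reals_iff)
  \<comment> \<open>The case \<open>\<zeta> = \<i> \<xi>\<close>: the imaginary part identifies \<open>Y\<close> with \<open>\<parallel>\<eta>\<parallel>\<^sup>2\<close>, which stands
    in for the fact that \<open>\<Phi>\<close> preserves adjoints.\<close>
  have "of_real N - \<i> * of_real N + \<i> * Y + of_real M \<in> \<real>\<^sub>\<ge>\<^sub>0"
    using key[OF ell2_scale[OF \<xi>, of \<i>]] X2
    by (simp add: Y_def M_def ell2_inner_self[OF \<xi>] ell2_inner_scale_left ell2_inner_scale_right)
  then have "Re Y = N" by (auto simp: complex_nonneg_Reals_iff)
  with Y have "N \<le> M" by simp
  then have "(ell2_norm I \<eta>)\<^sup>2 \<le> (s * ell2_norm I \<xi>)\<^sup>2"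
    by (simp add: N_def M_def power_mult_distrib)
  then show ?thesis
    unfolding \<eta>_def by (rule power2_le_imp_le) (simp add: s(1) ell2_norm_nonneg)
qed

text \<open>The Riesz representation theorem for states of \<open>C(X)\<close>.  The state is real on real functions, since these are
  differences of nonnegative ones; its restriction to them is represented by the measure constructed above, and the
  representation extends to complex functions by linearity.\<close>

lemma state_representation:
  assumes X: "compact_space X" "Hausdorff_space X"
    and add: "\<And>f g. f \<in> C_carrier X \<Longrightarrow> g \<in> C_carrier X \<Longrightarrow> S (\<lambda>x. f x + g x) = S f + S g"
    and scale: "\<And>a f. f \<in> C_carrier X \<Longrightarrow> S (\<lambda>x. a * f x) = a * S f"
    and pos: "\<And>f. f \<in> C_carrier X \<Longrightarrow> (\<And>x. x \<in> topspace X \<Longrightarrow> f x \<in> \<real>\<^sub>\<ge>\<^sub>0) \<Longrightarrow> S f \<in> \<real>\<^sub>\<ge>\<^sub>0"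
    and unit: "S (\<lambda>x. if x \<in> topspace X then 1 else 0) = (1::complex)"
  obtains \<nu> where "\<nu> \<in> Prob X" "\<And>f. f \<in> C_carrier X \<Longrightarrow> integral\<^sup>L \<nu> f = S f"
proof -
  have lift_add: "lift X (\<lambda>x. f x + g x) = (\<lambda>x. lift X f x + lift X g x)" for f g
    by (auto simp: lift_def)
  have lift_scale: "lift X (\<lambda>x. c * f x) = (\<lambda>x. complex_of_real c * lift X f x)" for c f
    by (auto simp: lift_def)
  have lift_pos: "S (lift X f) \<in> \<real>\<^sub>\<ge>\<^sub>0"
    if "continuous_map X euclideanreal f" "\<And>x. x \<in> topspace X \<Longrightarrow> 0 \<le> f x" for f
    using that by (intro pos lift_in_C_carrier) (auto simp: lift_def)
  have lift_real: "Im (S (lift X f)) = 0" if fc: "continuous_map X euclideanreal f" for f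
  proof -
    have c: "continuous_map X euclideanreal (\<lambda>x. max (f x) 0)"
      "continuous_map X euclideanreal (\<lambda>x. max (- f x) 0)"
      using fc by (auto intro!: continuous_intros)
    have "lift X f = lift X (\<lambda>x. max (f x) 0 + (-1) * max (- f x) 0)"
      by (auto simp: lift_def max_def)
    then have "S (lift X f) = S (lift X (\<lambda>x. max (f x) 0 + (-1) * max (- f x) 0))"
      by simp
    also have "\<dots> = S (lift X (\<lambda>x. max (f x) 0)) + (-1) * S (lift X (\<lambda>x. max (- f x) 0))"
      unfolding lift_add lift_scale add[OF lift_in_C_carrier[OF c(1)] C_carrier_scale[OF lift_in_C_carrier[OF c(2)]]]
        scale[OF lift_in_C_carrier[OF c(2)]] by simp
    finally show ?thesis
      using lift_pos[OF c(1)] lift_pos[OF c(2)] by (auto simp: complex_nonneg_Reals_iff)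
  qed
  define L where "L f = Re (S (lift X f))" for f
  have S_lift: "S (lift X f) = of_real (L f)" if "continuous_map X euclideanreal f" for f
    using lift_real[OF that] by (simp add: L_def complex_eq_iff)
  interpret L: positive_functional X L
  proof
    show cL: "L (\<lambda>x. f x + g x) = L f + L g"
      if "continuous_map X euclideanreal f" "continuous_map X euclideanreal g" for f g
      using that by (simp add: L_def lift_add add lift_in_C_carrier)
    show sL: "L (\<lambda>x. c * f x) = c * L f" if "continuous_map X euclideanreal f" for c f
      using that by (simp add: L_def lift_scale scale lift_in_C_carrier)
    show "L f \<le> L g" if fc: "continuous_map X euclideanreal f" and gc: "continuous_map X euclideanreal g"
      and le: "\<And>x. x \<in> topspace X \<Longrightarrow> f x \<le> g x" for f g
    proof -
      have "continuous_map X euclideanreal (\<lambda>x. g x + (-1) * f x)"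
        using fc gc by (intro continuous_intros) auto
      then have "0 \<le> L (\<lambda>x. g x + (-1) * f x)"
        using lift_pos le by (simp add: L_def complex_nonneg_Reals_iff)
      also have "\<dots> = L g + (-1) * L f"
        unfolding cL[OF gc continuous_map_real_mult_left[OF fc]] sL[OF fc] ..
      finally show ?thesis by simp
    qed
  qed (use X in auto)
  have "L.total = 1"
    using unit unfolding L_def lift_def of_real_1 by simp
  then have P: "L.riesz_measure \<in> Prob X" by (rule L.riesz_measure_in_Prob)
  have int_lift: "integral\<^sup>L L.riesz_measure (lift X f) = of_real (integral\<^sup>L L.riesz_measure f)"
    for f :: "'a \<Rightarrow> real"
    unfolding integral_complex_of_real[symmetric]
    by (intro Bochner_Integration.integral_cong) (auto simp: lift_def L.space_riesz_measure)
  have "integral\<^sup>L L.riesz_measure f = S f" if f: "f \<in> C_carrier X" for f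
  proof -
    let ?r = "lift X (\<lambda>x. Re (f x))" and ?j = "lift X (\<lambda>x. Im (f x))"
    note c = continuous_map_C_D(1,2)[OF f]
    have rj: "?r \<in> C_carrier X" "?j \<in> C_carrier X" "(\<lambda>x. \<i> * ?j x) \<in> C_carrier X"
      using c by (auto intro: lift_in_C_carrier C_carrier_scale)
    note int = Prob_integrable[OF P X(1) C_carrier_D(1)]
    have f_eq: "f = (\<lambda>x. ?r x + \<i> * ?j x)"
      using C_carrier_D(2)[OF f] by (auto simp: lift_def complex_eq_iff)
    have "integral\<^sup>L L.riesz_measure f =
        integral\<^sup>L L.riesz_measure ?r + \<i> * integral\<^sup>L L.riesz_measure ?j"
      by (subst f_eq) (simp add: int rj)
    also have "\<dots> = S ?r + \<i> * S ?j"
      using c by (simp add: int_lift S_lift L.L_eq_integral)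
    also have "\<dots> = S (\<lambda>x. ?r x + \<i> * ?j x)"
      using rj by (simp add: add scale)
    finally show ?thesis using f_eq by simp
  qed
  with P show ?thesis by (rule that)
qed

section \<open>Sums and integrals of nonnegative complex numbers\<close>

lemma has_sum_sum:
  fixes f :: "'a \<Rightarrow> 'b \<Rightarrow> 'c::topological_comm_monoid_add"
  assumes "finite A" "\<And>a. a \<in> A \<Longrightarrow> (f a has_sum s a) B"
  shows "((\<lambda>x. \<Sum>a\<in>A. f a x) has_sum (\<Sum>a\<in>A. s a)) B"
  using assms by (induction A) (auto intro: has_sum_add)

lemma has_sum_nonneg_Reals:
  fixes f :: "'a \<Rightarrow> complex"
  assumes "(f has_sum s) A" "\<And>x. x \<in> A \<Longrightarrow> f x \<in> \<real>\<^sub>\<ge>\<^sub>0"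
  shows "s \<in> \<real>\<^sub>\<ge>\<^sub>0"
proof -
  have "0 \<le> Re s"
    by (rule has_sum_nonneg[OF has_sum_Re[OF assms(1)]]) (use assms(2) in \<open>simp add: complex_nonneg_Reals_iff\<close>)
  moreover have "((\<lambda>x. Im (f x)) has_sum 0) A"
    using assms(2) by (intro has_sum_0) (auto simp: complex_nonneg_Reals_iff)
  then have "Im s = 0" using has_sum_Im[OF assms(1)] by (rule has_sum_unique[symmetric])
  ultimately show ?thesis by (simp add: complex_nonneg_Reals_iff)
qed

lemma integral_nonneg_Reals:
  fixes f :: "'a \<Rightarrow> complex"
  assumes "integrable M f" "\<And>x. x \<in> space M \<Longrightarrow> f x \<in> \<real>\<^sub>\<ge>\<^sub>0"
  shows "integral\<^sup>L M f \<in> \<real>\<^sub>\<ge>\<^sub>0"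
proof -
  have "Im (integral\<^sup>L M f) = (\<integral>x. Im (f x) \<partial>M)" "Re (integral\<^sup>L M f) = (\<integral>x. Re (f x) \<partial>M)"
    using assms(1) by simp_all
  moreover have "(\<integral>x. Im (f x) \<partial>M) = 0"
    using assms(2) by (intro integral_eq_zero_AE AE_I2) (auto simp: complex_nonneg_Reals_iff)
  moreover have "0 \<le> (\<integral>x. Re (f x) \<partial>M)"
    using assms(2) by (intro integral_nonneg_AE AE_I2) (auto simp: complex_nonneg_Reals_iff)
  ultimately show ?thesis by (simp add: complex_nonneg_Reals_iff)
qed

section \<open>The group action\<close>

text \<open>The action of \<open>G\<close> on \<open>X\<close> together with the subgroup \<open>H\<close>.\<close>

locale coset_setting =
  fixes G :: "('g, 'm) monoid_scheme" (structure) and H :: "'g set"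
    and X :: "'x topology" and \<phi> :: "'g \<Rightarrow> 'x \<Rightarrow> 'x"
  assumes group: "group G" and subgroup: "subgroup H G"
    and compact: "compact_space X" and Hausdorff: "Hausdorff_space X"
    and action: "homeo_action G X \<phi>"

sublocale coset_setting \<subseteq> group G by (rule group)

context coset_setting
begin

abbreviation "cosets \<equiv> lcosets H"

abbreviation "ucp \<equiv> equivariant_ucp_map G (C_system X) (C_action G X \<phi>) (B_system cosets) (B_action G H)"

lemma H_sub: "H \<subseteq> carrier G"
  using subgroup by (rule subgroup.subset)

lemma act_group_action: "group_action G (topspace X) \<phi>"
  using action by (simp add: homeo_action_def)

lemma act_continuous: "g \<in> carrier G \<Longrightarrow> continuous_map X X (\<phi> g)"
  using action by (simp add: homeo_action_def homeomorphic_imp_continuous_map)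

lemma act_closed: "g \<in> carrier G \<Longrightarrow> x \<in> topspace X \<Longrightarrow> \<phi> g x \<in> topspace X"
  using act_continuous[of g] by (auto simp: continuous_map_def)

lemma act_mult:
  "x \<in> topspace X \<Longrightarrow> g \<in> carrier G \<Longrightarrow> h \<in> carrier G \<Longrightarrow> \<phi> (g \<otimes> h) x = \<phi> g (\<phi> h x)"
  by (rule group_action.composition_rule[OF act_group_action])

lemma comp_act_continuous:
  assumes "f \<in> C_carrier X" "g \<in> carrier G"
  shows "continuous_map X euclidean (\<lambda>x. f (\<phi> g x))"
  using continuous_map_compose[OF act_continuous[OF assms(2)] C_carrier_D(1)[OF assms(1)]]
  by (simp add: o_def)

lemma C_action_in_C_carrier:
  assumes "f \<in> C_carrier X" "g \<in> carrier G" shows "C_action G X \<phi> g f \<in> C_carrier X"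
proof -
  have "continuous_map X euclidean (C_action G X \<phi> g f)"
    using comp_act_continuous[OF assms(1) inv_closed[OF assms(2)]]
    by (rule continuous_map_eq) (simp add: C_action_def)
  then show ?thesis by (simp add: C_carrier_def C_action_def)
qed

lemma coset_in_cosets: "g \<in> carrier G \<Longrightarrow> g <# H \<in> cosets"
  by (auto simp: LCOSETS_def)

lemma cosets_cases:
  assumes "c \<in> cosets" obtains g where "g \<in> carrier G" "c = g <# H"
  using assms by (auto simp: LCOSETS_def)

lemma coset_mult: "g \<in> carrier G \<Longrightarrow> k \<in> carrier G \<Longrightarrow> g <# (k <# H) = (g \<otimes> k) <# H"
  using H_sub by (rule lcos_m_assoc)

lemma H_in_cosets: "H \<in> cosets"
  using coset_in_cosets[OF one_closed] H_sub by (simp add: lcos_mult_one)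

lemma coset_of_H:
  assumes "h \<in> H" shows "h <# H = H"
proof -
  interpret H: subgroup H G by (rule subgroup)
  show ?thesis
  proof
    show "h <# H \<subseteq> H" using assms by (auto simp: l_coset_def)
    show "H \<subseteq> h <# H"
    proof
      fix k assume k: "k \<in> H"
      have "k = h \<otimes> (inv h \<otimes> k)"
        using assms k by (simp add: m_assoc[symmetric])
      moreover have "inv h \<otimes> k \<in> H" using assms k by simp
      ultimately show "k \<in> h <# H" unfolding l_coset_def by blast
    qed
  qed
qed

lemma quasi_regular_in_ell2:
  assumes \<xi>: "\<xi> \<in> ell2 cosets" and g: "g \<in> carrier G"
  shows "quasi_regular G H g \<xi> \<in> ell2 cosets"
proof -
  have "bij_betw (\<lambda>c. inv g <# c) cosets cosets"
  proof (rule bij_betw_byWitness[where f' = "\<lambda>c. g <# c"])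
    show "\<forall>c\<in>cosets. g <# (inv g <# c) = c" "\<forall>c\<in>cosets. inv g <# (g <# c) = c"
      using g by (auto elim!: cosets_cases simp: coset_mult simp flip: m_assoc)
    show "(\<lambda>c. inv g <# c) ` cosets \<subseteq> cosets" "(\<lambda>c. g <# c) ` cosets \<subseteq> cosets"
      using g by (auto elim!: cosets_cases simp: coset_mult coset_in_cosets)
  qed
  from summable_on_reindex_bij_betw[OF this, of "\<lambda>c. (cmod (\<xi> c))\<^sup>2"] ell2_D(1)[OF \<xi>]
  have "(\<lambda>c. (cmod (\<xi> (inv g <# c)))\<^sup>2) summable_on cosets" by simp
  then have "(\<lambda>c. (cmod (quasi_regular G H g \<xi> c))\<^sup>2) summable_on cosets"
    by (rule summable_on_cong[THEN iffD1, rotated]) (simp add: quasi_regular_def \<xi>)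
  then show ?thesis by (simp add: ell2_def quasi_regular_def)
qed

lemma translate_in_cosets: "g \<in> carrier G \<Longrightarrow> c \<in> cosets \<Longrightarrow> g <# c \<in> cosets"
  by (auto elim!: cosets_cases simp: coset_mult coset_in_cosets)

lemma integral_push_measure:
  fixes f :: "'x \<Rightarrow> 'b::{banach, second_countable_topology}"
  assumes "\<nu> \<in> Prob X" "g \<in> carrier G" "continuous_map X euclidean f"
  shows "integral\<^sup>L (push_measure X \<phi> g \<nu>) f = (\<integral>x. f (\<phi> g x) \<partial>\<nu>)"
  unfolding push_measure_def
  by (intro integral_distr measurable_continuous_map[OF Prob_D(3)[OF assms(1)] act_continuous[OF assms(2)]]
      continuous_map_measurable[OF refl assms(3)])

section \<open>From invariant measures to equivariant maps\<close>

text \<open>The value at a coset \<open>c = g H\<close> of the Poisson transform of \<open>f\<close>, computed with an arbitrary representative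
  of \<open>c\<close>; invariance of \<open>\<nu>\<close> under \<open>H\<close> makes the choice irrelevant.\<close>

definition coset_integral :: "'x measure \<Rightarrow> ('x \<Rightarrow> complex) \<Rightarrow> 'g set \<Rightarrow> complex" where
  "coset_integral \<nu> f c = (\<integral>x. f (\<phi> (SOME g. g \<in> c) x) \<partial>\<nu>)"

text \<open>The Poisson map of \<open>\<nu>\<close>: \<open>f\<close> acts as multiplication by its Poisson transform.\<close>

definition poisson :: "'x measure \<Rightarrow> ('x \<Rightarrow> complex) \<Rightarrow> ('g set \<Rightarrow> complex) \<Rightarrow> 'g set \<Rightarrow> complex" where
  "poisson \<nu> f = diag_op cosets (coset_integral \<nu> f)"

lemma coset_integral_eq:
  assumes \<nu>: "\<nu> \<in> Prob_invariant H X \<phi>" and g: "g \<in> carrier G" and f: "f \<in> C_carrier X"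
  shows "coset_integral \<nu> f (g <# H) = (\<integral>x. f (\<phi> g x) \<partial>\<nu>)"
proof -
  have P: "\<nu> \<in> Prob X" using \<nu> by (simp add: Prob_invariant_def)
  have "(SOME k. k \<in> g <# H) \<in> g <# H"
    using lcos_self[OF g subgroup] by (rule someI)
  then obtain h where h: "h \<in> H" "(SOME k. k \<in> g <# H) = g \<otimes> h"
    by (auto simp: l_coset_def)
  then have hG: "h \<in> carrier G" using H_sub by blast
  have "coset_integral \<nu> f (g <# H) = (\<integral>x. f (\<phi> g (\<phi> h x)) \<partial>\<nu>)"
    unfolding coset_integral_def h(2)
    by (intro Bochner_Integration.integral_cong) (auto simp: act_mult g hG Prob_D(4)[OF P])
  also have "\<dots> = integral\<^sup>L (push_measure X \<phi> h \<nu>) (\<lambda>x. f (\<phi> g x))"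
    by (rule integral_push_measure[OF P hG comp_act_continuous[OF f g], symmetric])
  also have "push_measure X \<phi> h \<nu> = \<nu>"
    using \<nu> h(1) by (simp add: Prob_invariant_def)
  finally show ?thesis .
qed

lemma integral_bound:
  assumes "\<nu> \<in> Prob X" "f \<in> C_carrier X" "g \<in> carrier G"
    and K: "\<And>x. x \<in> topspace X \<Longrightarrow> cmod (f x) \<le> K"
  shows "cmod (\<integral>x. f (\<phi> g x) \<partial>\<nu>) \<le> K"
proof -
  interpret prob_space \<nu> by (rule Prob_D(1)[OF assms(1)])
  have "cmod (\<integral>x. f (\<phi> g x) \<partial>\<nu>) \<le> (\<integral>x. cmod (f (\<phi> g x)) \<partial>\<nu>)"
    by (rule integral_norm_bound)
  also have "\<dots> \<le> (\<integral>x. K \<partial>\<nu>)"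
    using K act_closed[OF assms(3)] Prob_D(4)[OF assms(1)]
    by (intro integral_mono integrable_norm
        Prob_integrable[OF assms(1) compact comp_act_continuous[OF assms(2,3)]]) auto
  finally show ?thesis by (simp add: prob_space)
qed

lemma coset_integral_bound:
  assumes "\<nu> \<in> Prob_invariant H X \<phi>" "f \<in> C_carrier X" "c \<in> cosets"
    and "\<And>x. x \<in> topspace X \<Longrightarrow> cmod (f x) \<le> K"
  shows "cmod (coset_integral \<nu> f c) \<le> K"
  using assms by (auto elim!: cosets_cases simp: coset_integral_eq Prob_invariant_def intro!: integral_bound)

lemma poisson_bounded:
  assumes "\<nu> \<in> Prob_invariant H X \<phi>" "f \<in> C_carrier X"
  shows "poisson \<nu> f \<in> B_carrier cosets"
  unfolding poisson_def
  by (rule diag_op_bounded[OF coset_integral_bound[OF assms _ C_norm_upper[OF compact assms(2)]]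
        C_norm_nonneg[OF compact assms(2)]])

text \<open>The quadratic form of the image of a matrix is the sum over the cosets \<open>g H\<close> of the integrals of the quadratic
  forms of the matrix at the points \<open>g x\<close>, each of which is nonnegative.\<close>

lemma poisson_completely_positive:
  assumes \<nu>: "\<nu> \<in> Prob_invariant H X \<phi>"
  shows "completely_positive (C_system X) (B_system cosets) (poisson \<nu>)"
  unfolding completely_positive_def
proof (intro allI ballI)
  fix n F assume "F \<in> os_pos (C_system X) n"
  then have F: "\<And>i j. i < n \<Longrightarrow> j < n \<Longrightarrow> F i j \<in> C_carrier X"
    and pos: "\<And>x v. x \<in> topspace X \<Longrightarrow> (\<Sum>i<n. \<Sum>j<n. cnj (v i) * F i j x * v j) \<in> \<real>\<^sub>\<ge>\<^sub>0"
    unfolding C_system_def op_system.simps by auto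
  have P: "\<nu> \<in> Prob X" using \<nu> by (simp add: Prob_invariant_def)
  show "(\<lambda>i j. poisson \<nu> (F i j)) \<in> os_pos (B_system cosets) n"
    unfolding B_system_def op_system.simps
  proof (intro CollectI conjI allI impI)
    show "poisson \<nu> (F i j) \<in> B_carrier cosets" if "i < n" "j < n" for i j
      by (rule poisson_bounded[OF \<nu> F[OF that]])
    fix \<xi> :: "nat \<Rightarrow> 'g set \<Rightarrow> complex" assume \<xi>: "\<forall>i<n. \<xi> i \<in> ell2 cosets"
    let ?m = "\<lambda>i j. coset_integral \<nu> (F i j)"
    have sum1: "((\<lambda>c. ?m i j c * \<xi> j c * cnj (\<xi> i c)) has_sum
        ell2_inner cosets (poisson \<nu> (F i j) (\<xi> j)) (\<xi> i)) cosets" if "i < n" "j < n" for i j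
    proof -
      have "poisson \<nu> (F i j) (\<xi> j) \<in> ell2 cosets"
        using B_carrier_D(1)[OF poisson_bounded[OF \<nu> F[OF that]]] \<xi> that by blast
      from has_sum_infsum[OF ell2_inner_summable[OF this, of "\<xi> i"]] \<xi> that
      show ?thesis
        by (simp add: poisson_def diag_op_def ell2_inner_def)
    qed
    have "((\<lambda>c. \<Sum>i<n. \<Sum>j<n. ?m i j c * \<xi> j c * cnj (\<xi> i c)) has_sum
        (\<Sum>i<n. \<Sum>j<n. ell2_inner cosets (poisson \<nu> (F i j) (\<xi> j)) (\<xi> i))) cosets"
      by (intro has_sum_sum) (auto intro: sum1)
    then show "(\<Sum>i<n. \<Sum>j<n. ell2_inner cosets (poisson \<nu> (F i j) (\<xi> j)) (\<xi> i)) \<in> \<real>\<^sub>\<ge>\<^sub>0"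
    proof (rule has_sum_nonneg_Reals)
      fix c assume "c \<in> cosets"
      then obtain g where g: "g \<in> carrier G" "c = g <# H" by (rule cosets_cases)
      have int: "integrable \<nu> (\<lambda>x. F i j (\<phi> g x))" if "i < n" "j < n" for i j
        by (rule Prob_integrable[OF P compact comp_act_continuous[OF F[OF that] g(1)]])
      have "(\<Sum>i<n. \<Sum>j<n. ?m i j c * \<xi> j c * cnj (\<xi> i c)) =
          (\<Sum>i<n. \<Sum>j<n. \<integral>x. cnj (\<xi> i c) * F i j (\<phi> g x) * \<xi> j c \<partial>\<nu>)"
        using F g \<nu> by (intro sum.cong refl) (simp add: coset_integral_eq)
      also have "\<dots> = (\<integral>x. (\<Sum>i<n. \<Sum>j<n. cnj (\<xi> i c) * F i j (\<phi> g x) * \<xi> j c) \<partial>\<nu>)"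
      proof -
        have int': "integrable \<nu> (\<lambda>x. cnj (\<xi> i c) * F i j (\<phi> g x) * \<xi> j c)" if "i < n" "j < n" for i j
          using int[OF that] by simp
        have "(\<integral>x. (\<Sum>i<n. \<Sum>j<n. cnj (\<xi> i c) * F i j (\<phi> g x) * \<xi> j c) \<partial>\<nu>) =
            (\<Sum>i<n. \<integral>x. (\<Sum>j<n. cnj (\<xi> i c) * F i j (\<phi> g x) * \<xi> j c) \<partial>\<nu>)"
          using int' by (intro Bochner_Integration.integral_sum Bochner_Integration.integrable_sum) auto
        also have "\<dots> = (\<Sum>i<n. \<Sum>j<n. \<integral>x. cnj (\<xi> i c) * F i j (\<phi> g x) * \<xi> j c \<partial>\<nu>)"
          using int' by (intro sum.cong refl Bochner_Integration.integral_sum) auto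
        finally show ?thesis by (rule sym)
      qed
      also have "\<dots> \<in> \<real>\<^sub>\<ge>\<^sub>0"
      proof (rule integral_nonneg_Reals)
        show "integrable \<nu> (\<lambda>x. \<Sum>i<n. \<Sum>j<n. cnj (\<xi> i c) * F i j (\<phi> g x) * \<xi> j c)"
          using int by (intro Bochner_Integration.integrable_sum) auto
        show "(\<Sum>i<n. \<Sum>j<n. cnj (\<xi> i c) * F i j (\<phi> g x) * \<xi> j c) \<in> \<real>\<^sub>\<ge>\<^sub>0" if "x \<in> space \<nu>" for x
          using pos[of "\<phi> g x" "\<lambda>i. \<xi> i c"] act_closed[OF g(1)] that Prob_D(4)[OF P] by simp
      qed
      finally show "(\<Sum>i<n. \<Sum>j<n. ?m i j c * \<xi> j c * cnj (\<xi> i c)) \<in> \<real>\<^sub>\<ge>\<^sub>0" .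
    qed
  qed
qed

lemma poisson_equivariant:
  assumes \<nu>: "\<nu> \<in> Prob_invariant H X \<phi>" and g: "g \<in> carrier G" and f: "f \<in> C_carrier X"
  shows "poisson \<nu> (C_action G X \<phi> g f) = B_action G H g (poisson \<nu> f)"
proof (rule ext)
  fix \<xi> :: "'g set \<Rightarrow> complex"
  have P: "\<nu> \<in> Prob X" using \<nu> by (simp add: Prob_invariant_def)
  note ig = inv_closed[OF g]
  show "poisson \<nu> (C_action G X \<phi> g f) \<xi> = B_action G H g (poisson \<nu> f) \<xi>"
  proof (cases "\<xi> \<in> ell2 cosets")
    case False
    then have "quasi_regular G H (inv g) \<xi> = (\<lambda>_. 0)" by (simp add: quasi_regular_def)
    moreover have "poisson \<nu> f (\<lambda>_. 0) = (\<lambda>_. 0)" by (simp add: poisson_def diag_op_def)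
    ultimately show ?thesis
      using False by (simp add: B_action_def poisson_def diag_op_def quasi_regular_def)
  next
    case True
    define \<zeta> where "\<zeta> = quasi_regular G H (inv g) \<xi>"
    have \<zeta>: "\<zeta> \<in> ell2 cosets" unfolding \<zeta>_def by (rule quasi_regular_in_ell2[OF True ig])
    have p\<zeta>: "poisson \<nu> f \<zeta> \<in> ell2 cosets"
      by (rule B_carrier_D(1)[OF poisson_bounded[OF \<nu> f] \<zeta>])
    have "poisson \<nu> (C_action G X \<phi> g f) \<xi> c = quasi_regular G H g (poisson \<nu> f \<zeta>) c" for c
    proof (cases "c \<in> cosets")
      case c: True
      then obtain k where k: "k \<in> carrier G" "c = k <# H" by (rule cosets_cases)
      have ik: "inv g \<otimes> k \<in> carrier G" using k ig by simp
      have "coset_integral \<nu> (C_action G X \<phi> g f) c = (\<integral>x. C_action G X \<phi> g f (\<phi> k x) \<partial>\<nu>)"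
        unfolding k(2) by (rule coset_integral_eq[OF \<nu> k(1) C_action_in_C_carrier[OF f g]])
      also have "\<dots> = (\<integral>x. f (\<phi> (inv g \<otimes> k) x) \<partial>\<nu>)"
        using k(1) ig
        by (intro Bochner_Integration.integral_cong)
           (auto simp: C_action_def act_closed act_mult Prob_D(4)[OF P])
      also have "\<dots> = coset_integral \<nu> f (inv g <# c)"
        using coset_integral_eq[OF \<nu> ik f] k ig by (simp add: coset_mult)
      finally have "coset_integral \<nu> (C_action G X \<phi> g f) c = coset_integral \<nu> f (inv g <# c)" .
      moreover have "\<zeta> (inv g <# c) = \<xi> c"
        using True c k ig g translate_in_cosets[OF ig c]
        by (simp add: \<zeta>_def quasi_regular_def coset_mult m_assoc[symmetric])
      ultimately show ?thesis
        using True \<zeta> p\<zeta> c by (simp add: poisson_def diag_op_def quasi_regular_def)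
    next
      case False
      then show ?thesis
        using ell2_D(2)[OF True False] by (simp add: poisson_def diag_op_def quasi_regular_def)
    qed
    then show ?thesis by (auto simp: B_action_def \<zeta>_def)
  qed
qed

lemma poisson_ucp:
  assumes \<nu>: "\<nu> \<in> Prob_invariant H X \<phi>" shows "ucp (poisson \<nu>)"
proof -
  have P: "\<nu> \<in> Prob X" using \<nu> by (simp add: Prob_invariant_def)
  interpret prob_space \<nu> by (rule Prob_D(1)[OF P])
  note int = Prob_integrable[OF P compact comp_act_continuous]
  have add: "poisson \<nu> (\<lambda>x. f x + k x) = (\<lambda>\<xi> i. poisson \<nu> f \<xi> i + poisson \<nu> k \<xi> i)"
    if "f \<in> C_carrier X" "k \<in> C_carrier X" for f k
  proof -
    have "coset_integral \<nu> (\<lambda>x. f x + k x) c = coset_integral \<nu> f c + coset_integral \<nu> k c"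
      if "c \<in> cosets" for c
      using that by (rule cosets_cases)
        (simp add: coset_integral_eq[OF \<nu>] int C_carrier_add \<open>f \<in> _\<close> \<open>k \<in> _\<close>)
    then have "poisson \<nu> (\<lambda>x. f x + k x) = diag_op cosets (\<lambda>c. coset_integral \<nu> f c + coset_integral \<nu> k c)"
      unfolding poisson_def by (rule diag_op_cong)
    then show ?thesis
      by (auto simp: poisson_def diag_op_def algebra_simps)
  qed
  have scale: "poisson \<nu> (\<lambda>x. a * f x) = (\<lambda>\<xi> i. a * poisson \<nu> f \<xi> i)"
    if "f \<in> C_carrier X" for a f
  proof -
    have "coset_integral \<nu> (\<lambda>x. a * f x) c = a * coset_integral \<nu> f c" if "c \<in> cosets" for c
      using that by (rule cosets_cases)
        (simp add: coset_integral_eq[OF \<nu>] int C_carrier_scale \<open>f \<in> _\<close>)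
    then have "poisson \<nu> (\<lambda>x. a * f x) = diag_op cosets (\<lambda>c. a * coset_integral \<nu> f c)"
      unfolding poisson_def by (rule diag_op_cong)
    then show ?thesis
      by (auto simp: poisson_def diag_op_def algebra_simps)
  qed
  have "coset_integral \<nu> (os_unit (C_system X)) c = 1" if "c \<in> cosets" for c
    using that
  proof (rule cosets_cases)
    fix g assume g: "g \<in> carrier G" "c = g <# H"
    have "coset_integral \<nu> (os_unit (C_system X)) c = (\<integral>x. 1 \<partial>\<nu>)"
      unfolding g(2) C_system_simps coset_integral_eq[OF \<nu> g(1) C_carrier_unit]
      by (intro Bochner_Integration.integral_cong) (auto simp: act_closed g(1) Prob_D(4)[OF P])
    then show ?thesis by (simp add: prob_space)
  qed
  then have "poisson \<nu> (os_unit (C_system X)) = diag_op cosets (\<lambda>_. 1)"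
    unfolding poisson_def by (rule diag_op_cong)
  then have unit: "poisson \<nu> (os_unit (C_system X)) = os_unit (B_system cosets)"
    by (auto simp: diag_op_def)
  show ?thesis
    unfolding equivariant_ucp_map_def os_linear_def
    using add scale unit poisson_bounded[OF \<nu>] poisson_completely_positive[OF \<nu>] poisson_equivariant[OF \<nu>]
    by simp
qed

section \<open>From equivariant maps to invariant measures\<close>

text \<open>The vector state at \<open>\<delta>\<^sub>H\<close> is represented by a measure; equivariance moves the other diagonal entries to this
  one, and the entry at \<open>h H = H\<close> for \<open>h \<in> H\<close> expresses invariance.\<close>

lemma ucp_measure:
  assumes \<Phi>: "ucp \<Phi>"
  obtains \<nu> where "\<nu> \<in> Prob_invariant H X \<phi>"
    "\<And>f g. f \<in> C_carrier X \<Longrightarrow> g \<in> carrier G \<Longrightarrow>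
      (\<integral>x. f (\<phi> g x) \<partial>\<nu>) = \<Phi> f (ell2_delta (g <# H)) (g <# H)"
proof -
  let ?d = "ell2_delta H"
  have lin: "os_linear (C_system X) (B_system cosets) \<Phi>"
    and unit: "\<Phi> (os_unit (C_system X)) = os_unit (B_system cosets)"
    and cp: "completely_positive (C_system X) (B_system cosets) \<Phi>"
    and eqv: "\<And>g f. g \<in> carrier G \<Longrightarrow> f \<in> C_carrier X \<Longrightarrow>
      \<Phi> (C_action G X \<phi> g f) = B_action G H g (\<Phi> f)"
    using \<Phi> by (auto simp: equivariant_ucp_map_def)
  have \<Phi>B: "\<Phi> f \<in> B_carrier cosets" if "f \<in> C_carrier X" for f
    using lin that by (simp add: os_linear_def)
  have d: "?d \<in> ell2 cosets" by (rule ell2_delta_in_ell2[OF H_in_cosets])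
  define S where "S f = \<Phi> f ?d H" for f
  obtain \<nu> where P: "\<nu> \<in> Prob X" and \<nu>S: "\<And>f. f \<in> C_carrier X \<Longrightarrow> integral\<^sup>L \<nu> f = S f"
  proof (rule state_representation[OF compact Hausdorff, of S])
    show "S (\<lambda>x. f x + g x) = S f + S g" if "f \<in> C_carrier X" "g \<in> C_carrier X" for f g
      using lin that by (simp add: os_linear_def S_def)
    show "S (\<lambda>x. a * f x) = a * S f" if "f \<in> C_carrier X" for a f
      using lin that by (simp add: os_linear_def S_def)
    show "S (\<lambda>x. if x \<in> topspace X then 1 else 0) = 1"
      using unit d by (simp add: S_def ell2_delta_def)
    show "S f \<in> \<real>\<^sub>\<ge>\<^sub>0" if f: "f \<in> C_carrier X" "\<And>x. x \<in> topspace X \<Longrightarrow> f x \<in> \<real>\<^sub>\<ge>\<^sub>0" for f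
    proof -
      \<comment> \<open>Positivity of the state is complete positivity for matrices of size \<open>1\<close>.\<close>
      have "(\<lambda>i j. f) \<in> os_pos (C_system X) 1"
        unfolding C_system_def op_system.simps
      proof (intro CollectI conjI allI impI ballI)
        fix x and v :: "nat \<Rightarrow> complex" assume "x \<in> topspace X"
        then obtain r where r: "0 \<le> r" "f x = of_real r"
          using f(2) by (auto simp: nonneg_Reals_def)
        have "cnj (v 0) * f x * v 0 = of_real (r * (cmod (v 0))\<^sup>2)"
          unfolding r(2) of_real_mult complex_norm_square by (simp add: ac_simps)
        then show "(\<Sum>i<1. \<Sum>j<1. cnj (v i) * f x * v j) \<in> \<real>\<^sub>\<ge>\<^sub>0"
          using r(1) by (simp only: lessThan_Suc One_nat_def) (simp add: nonneg_Reals_of_real_iff)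
      qed (use f in simp)
      from cp[unfolded completely_positive_def, rule_format, OF this]
      have "\<forall>\<xi>. (\<forall>i<1. \<xi> i \<in> ell2 cosets) \<longrightarrow>
          (\<Sum>i<1::nat. \<Sum>j<1::nat. ell2_inner cosets (\<Phi> f (\<xi> j)) (\<xi> i)) \<in> \<real>\<^sub>\<ge>\<^sub>0"
        unfolding B_system_def op_system.simps mem_Collect_eq by (rule conjunct2)
      from this[rule_format, of "\<lambda>_. ?d"] d
      have "(\<Sum>i<1::nat. \<Sum>j<1::nat. ell2_inner cosets (\<Phi> f ?d) ?d) \<in> \<real>\<^sub>\<ge>\<^sub>0"
        by simp
      then show ?thesis by (simp add: S_def ell2_inner_delta[OF H_in_cosets])
    qed
  qed (rule that)
  have key: "(\<integral>x. f (\<phi> g x) \<partial>\<nu>) = \<Phi> f (ell2_delta (g <# H)) (g <# H)"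
    if f: "f \<in> C_carrier X" and g: "g \<in> carrier G" for f g
  proof -
    note ig = inv_closed[OF g]
    have gd: "quasi_regular G H g ?d = ell2_delta (g <# H)"
      using quasi_regular_delta[OF group subgroup g one_closed] g H_sub by (simp add: lcos_mult_one)
    have \<Phi>d: "\<Phi> f (ell2_delta (g <# H)) \<in> ell2 cosets"
      by (rule B_carrier_D(1)[OF \<Phi>B[OF f] ell2_delta_in_ell2[OF coset_in_cosets[OF g]]])
    have "(\<integral>x. f (\<phi> g x) \<partial>\<nu>) = integral\<^sup>L \<nu> (C_action G X \<phi> (inv g) f)"
      using g by (intro Bochner_Integration.integral_cong) (auto simp: C_action_def Prob_D(4)[OF P])
    also have "\<dots> = B_action G H (inv g) (\<Phi> f) ?d H"
      using f ig by (simp add: \<nu>S C_action_in_C_carrier S_def eqv)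
    also have "\<dots> = \<Phi> f (ell2_delta (g <# H)) (g <# H)"
      using g \<Phi>d H_in_cosets by (simp add: B_action_def gd) (simp add: quasi_regular_def)
    finally show ?thesis .
  qed
  have "push_measure X \<phi> h \<nu> = \<nu>" if h: "h \<in> H" for h
  proof (rule Prob_eqI[OF compact Hausdorff _ P])
    have hG: "h \<in> carrier G" using h H_sub by blast
    show "push_measure X \<phi> h \<nu> \<in> Prob X"
      unfolding push_measure_def by (rule Prob_distr[OF Hausdorff P act_continuous[OF hG]])
    fix f :: "'x \<Rightarrow> real" assume fc: "continuous_map X euclideanreal f"
    note l = lift_in_C_carrier[OF fc]
    have "complex_of_real (integral\<^sup>L (push_measure X \<phi> h \<nu>) f) = (\<integral>x. lift X f (\<phi> h x) \<partial>\<nu>)"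
      unfolding integral_push_measure[OF P hG fc] integral_complex_of_real[symmetric]
      by (intro Bochner_Integration.integral_cong) (auto simp: lift_def act_closed hG Prob_D(4)[OF P])
    also have "\<dots> = integral\<^sup>L \<nu> (lift X f)"
      using key[OF l hG] by (simp add: coset_of_H[OF h] \<nu>S[OF l] S_def)
    also have "\<dots> = complex_of_real (integral\<^sup>L \<nu> f)"
      unfolding integral_complex_of_real[symmetric]
      by (intro Bochner_Integration.integral_cong) (auto simp: lift_def Prob_D(4)[OF P])
    finally show "integral\<^sup>L (push_measure X \<phi> h \<nu>) f = integral\<^sup>L \<nu> f"
      by (simp only: of_real_eq_iff)
  qed
  with P have "\<nu> \<in> Prob_invariant H X \<phi>" by (simp add: Prob_invariant_def)
  then show ?thesis using key by (rule that)
qed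

section \<open>Isometric maps and contractible measures\<close>

lemma ucp_isometric:
  assumes \<Phi>: "ucp \<Phi>" and sub: "Prob_invariant H X \<phi> \<subseteq> Prob_contractible G X \<phi>"
  shows "os_isometric (C_system X) (B_system cosets) \<Phi>"
  unfolding os_isometric_def C_system_simps
proof
  fix f assume f: "f \<in> C_carrier X"
  obtain \<nu> where \<nu>: "\<nu> \<in> Prob_invariant H X \<phi>"
    and key: "\<And>f g. f \<in> C_carrier X \<Longrightarrow> g \<in> carrier G \<Longrightarrow>
      (\<integral>x. f (\<phi> g x) \<partial>\<nu>) = \<Phi> f (ell2_delta (g <# H)) (g <# H)"
    by (rule ucp_measure[OF \<Phi>]) blast
  have P: "\<nu> \<in> Prob X" using \<nu> by (simp add: Prob_invariant_def)
  have lin: "os_linear (C_system X) (B_system cosets) \<Phi>"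
    and unit: "\<Phi> (os_unit (C_system X)) = os_unit (B_system cosets)"
    and cp: "completely_positive (C_system X) (B_system cosets) \<Phi>"
    using \<Phi> by (auto simp: equivariant_ucp_map_def)
  have \<Phi>f: "\<Phi> f \<in> B_carrier cosets"
    using lin f by (simp add: os_linear_def)
  let ?N = "os_norm (B_system cosets) (\<Phi> f)"
  show "?N = os_norm (C_system X) f"
  proof (rule antisym)
    show "?N \<le> os_norm (C_system X) f"
      by (intro op_norm_least cp_contractive[OF lin unit cp f] C_norm_nonneg[OF compact f]
          C_norm_upper[OF compact f])
    show "os_norm (C_system X) f \<le> ?N"
    proof (rule C_norm_least)
      show "0 \<le> ?N"
        by (rule order_trans[OF norm_ge_zero op_norm_diagonal_entry[OF \<Phi>f H_in_cosets]])
      fix x assume x: "x \<in> topspace X"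
      show "cmod (f x) \<le> ?N"
      proof (rule field_le_epsilon)
        fix e :: real assume e: "0 < e"
        let ?d = "return (borel_of X) x"
        have "?d \<in> weak_star X closure_of ((\<lambda>g. push_measure X \<phi> g \<nu>) ` carrier G)"
          using sub \<nu> x by (auto simp: Prob_contractible_def contractible_measure_def)
        then have dense: "\<exists>\<mu>. \<mu> \<in> (\<lambda>g. push_measure X \<phi> g \<nu>) ` carrier G \<and> \<mu> \<in> T"
          if "?d \<in> T" "openin (weak_star X) T" for T
          using that unfolding in_closure_of by simp
        have "?d \<in> {\<mu> \<in> Prob X. cmod (integral\<^sup>L \<mu> f - f x) < e}"
          using e return_in_Prob[OF x Hausdorff]
          by (simp add: integral_return_borel_of[OF x C_carrier_D(1)[OF f]])
        from dense[OF this weak_star_openin_ball[OF f]] obtain g where g: "g \<in> carrier G"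
          "cmod (integral\<^sup>L (push_measure X \<phi> g \<nu>) f - f x) < e"
          by auto
        have "integral\<^sup>L (push_measure X \<phi> g \<nu>) f = \<Phi> f (ell2_delta (g <# H)) (g <# H)"
          using integral_push_measure[OF P g(1) C_carrier_D(1)[OF f]] key[OF f g(1)] by simp
        moreover have "cmod (\<Phi> f (ell2_delta (g <# H)) (g <# H)) \<le> ?N"
          by (rule op_norm_diagonal_entry[OF \<Phi>f coset_in_cosets[OF g(1)]])
        ultimately show "cmod (f x) \<le> ?N + e"
          using g(2) norm_triangle_sub[of "f x" "integral\<^sup>L (push_measure X \<phi> g \<nu>) f"]
          by (simp add: norm_minus_commute)
      qed
    qed
  qed
qed

text \<open>The test function \<open>M - s\<close> has norm at least \<open>M\<close>, the value at \<open>x\<close>.  By isometry some coset integral of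
  it exceeds \<open>M - e\<close> in absolute value, so the integral of \<open>s\<close> against a translate of \<open>\<nu>\<close> is less than \<open>e\<close>.\<close>

lemma isometric_contractible:
  assumes \<nu>: "\<nu> \<in> Prob_invariant H X \<phi>"
    and iso: "os_isometric (C_system X) (B_system cosets) (poisson \<nu>)"
  shows "contractible_measure G X \<phi> \<nu>"
  unfolding contractible_measure_def in_closure_of topspace_weak_star
proof (intro ballI conjI allI impI)
  fix x assume x: "x \<in> topspace X"
  let ?d = "return (borel_of X) x"
  have P: "\<nu> \<in> Prob X" using \<nu> by (simp add: Prob_invariant_def)
  interpret prob_space \<nu> by (rule Prob_D(1)[OF P])
  show "?d \<in> Prob X" by (rule return_in_Prob[OF x Hausdorff])
  fix T assume "?d \<in> T \<and> openin (weak_star X) T"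
  then obtain F e where F: "finite F" "F \<subseteq> C_carrier X" and e: "0 < (e::real)"
    and T: "\<And>\<mu>. \<mu> \<in> Prob X \<Longrightarrow>
      (\<And>f. f \<in> F \<Longrightarrow> cmod (integral\<^sup>L \<mu> f - integral\<^sup>L ?d f) < e) \<Longrightarrow> \<mu> \<in> T"
    using weak_star_neighbourhood[of X T ?d] by (metis (no_types))
  define s where "s y = (\<Sum>f\<in>F. cmod (f y - f x))" for y
  have sc: "continuous_map X euclideanreal s"
    unfolding s_def using F by (intro continuous_map_sum continuous_map_C_D(3)) auto
  have s0: "0 \<le> s y" for y by (simp add: s_def sum_nonneg)
  obtain B where B: "\<And>y. y \<in> topspace X \<Longrightarrow> norm (s y) \<le> B"
    using continuous_map_bounded[OF compact sc] by blast
  \<comment> \<open>\<open>M\<close> bounds \<open>s\<close>, so that \<open>M - s\<close> is nonnegative, and \<open>M \<ge> e\<close> makes \<open>M - e\<close> a valid bound of a norm.\<close>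
  define M where "M = max B e"
  have M: "e \<le> M" "\<And>y. y \<in> topspace X \<Longrightarrow> s y \<le> M"
    using B by (auto simp: M_def) (meson abs_le_D1 max.coboundedI1)
  define h where "h = lift X (\<lambda>y. M - s y)"
  have hC: "h \<in> C_carrier X"
    unfolding h_def using sc by (intro lift_in_C_carrier continuous_intros) auto
  have "M \<le> os_norm (C_system X) h"
    using C_norm_upper[OF compact hC x] x e M(1) by (simp add: h_def lift_def s_def)
  also have "\<dots> = os_norm (B_system cosets) (poisson \<nu> h)"
    using iso hC by (simp add: os_isometric_def)
  finally have norm: "M \<le> os_norm (B_system cosets) (poisson \<nu> h)" .
  have "\<exists>g\<in>carrier G. M - e < cmod (\<integral>y. h (\<phi> g y) \<partial>\<nu>)"
  proof (rule ccontr)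
    assume "\<not> ?thesis"
    then have "cmod (coset_integral \<nu> h c) \<le> M - e" if "c \<in> cosets" for c
      using that by (auto elim!: cosets_cases simp: coset_integral_eq[OF \<nu> _ hC] not_less)
    then have "os_norm (B_system cosets) (poisson \<nu> h) \<le> M - e"
      unfolding poisson_def using M(1) by (intro op_norm_least diag_op_bounded(2)) auto
    with norm e show False by simp
  qed
  then obtain g where g: "g \<in> carrier G" and gM: "M - e < cmod (\<integral>y. h (\<phi> g y) \<partial>\<nu>)" by blast
  have sgc: "continuous_map X euclideanreal (\<lambda>y. s (\<phi> g y))"
    using continuous_map_compose[OF act_continuous[OF g] sc] by (simp add: o_def)
  note sgi = Prob_integrable[OF P compact sgc]
  have "(\<integral>y. h (\<phi> g y) \<partial>\<nu>) = complex_of_real (\<integral>y. M - s (\<phi> g y) \<partial>\<nu>)"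
    unfolding integral_complex_of_real[symmetric]
    by (intro Bochner_Integration.integral_cong) (auto simp: h_def lift_def act_closed g Prob_D(4)[OF P])
  also have "(\<integral>y. M - s (\<phi> g y) \<partial>\<nu>) = M - (\<integral>y. s (\<phi> g y) \<partial>\<nu>)"
    using sgi by (simp add: prob_space)
  also have "cmod (complex_of_real (M - (\<integral>y. s (\<phi> g y) \<partial>\<nu>))) = M - (\<integral>y. s (\<phi> g y) \<partial>\<nu>)"
  proof -
    have "(\<integral>y. s (\<phi> g y) \<partial>\<nu>) \<le> (\<integral>y. M \<partial>\<nu>)"
      using sgi M(2) act_closed[OF g] by (intro integral_mono) (auto simp: Prob_D(4)[OF P])
    then show ?thesis unfolding norm_of_real by (simp add: prob_space)
  qed
  finally have small: "(\<integral>y. s (\<phi> g y) \<partial>\<nu>) < e"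
    using gM by simp
  have "push_measure X \<phi> g \<nu> \<in> T"
  proof (rule T)
    show "push_measure X \<phi> g \<nu> \<in> Prob X"
      unfolding push_measure_def by (rule Prob_distr[OF Hausdorff P act_continuous[OF g]])
    fix f assume fF: "f \<in> F"
    then have f: "f \<in> C_carrier X" using F(2) by blast
    note fi = Prob_integrable[OF P compact comp_act_continuous[OF f g]]
    have "integral\<^sup>L (push_measure X \<phi> g \<nu>) f - integral\<^sup>L ?d f = (\<integral>y. f (\<phi> g y) - f x \<partial>\<nu>)"
      using fi by (simp add: integral_push_measure[OF P g C_carrier_D(1)[OF f]]
          integral_return_borel_of[OF x C_carrier_D(1)[OF f]] prob_space)
    also have "cmod \<dots> \<le> (\<integral>y. cmod (f (\<phi> g y) - f x) \<partial>\<nu>)"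
      by (rule integral_norm_bound)
    also have "\<dots> \<le> (\<integral>y. s (\<phi> g y) \<partial>\<nu>)"
    proof (rule integral_mono)
      show "integrable \<nu> (\<lambda>y. cmod (f (\<phi> g y) - f x))" using fi by simp
      show "cmod (f (\<phi> g y) - f x) \<le> s (\<phi> g y)" for y
        unfolding s_def using F(1) fF by (intro member_le_sum) auto
    qed (rule sgi)
    finally show "cmod (integral\<^sup>L (push_measure X \<phi> g \<nu>) f - integral\<^sup>L ?d f) < e"
      using small by simp
  qed
  then show "\<exists>\<mu>. \<mu> \<in> (\<lambda>g. push_measure X \<phi> g \<nu>) ` carrier G \<and> \<mu> \<in> T"
    using g by (intro exI[of _ "push_measure X \<phi> g \<nu>"] conjI imageI)
qed

end

theorem theorem7p8:
  fixes G :: "('g, 'm) monoid_scheme" and H :: "'g set"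
    and X :: "'x topology" and \<phi> :: "'g \<Rightarrow> 'x \<Rightarrow> 'x"
  assumes "group G" and "subgroup H G"
    and "compact_space X" and "Hausdorff_space X"
    and "homeo_action G X \<phi>"
  shows "coset_boundary G H X \<phi> \<longleftrightarrow>
           {} \<noteq> Prob_invariant H X \<phi> \<and> Prob_invariant H X \<phi> \<subseteq> Prob_contractible G X \<phi>"
proof -
  interpret coset_setting G H X \<phi> by (rule coset_setting.intro) (rule assms)+
  have boundary: "coset_boundary G H X \<phi> \<longleftrightarrow> (\<exists>\<Phi>. ucp \<Phi>) \<and>
      (\<forall>\<Phi>. ucp \<Phi> \<longrightarrow> os_isometric (C_system X) (B_system (lcosets\<^bsub>G\<^esub> H)) \<Phi>)"
    by (simp add: coset_boundary_def Let_def)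
  show ?thesis
  proof
    assume "coset_boundary G H X \<phi>"
    then have ex: "\<exists>\<Phi>. ucp \<Phi>"
      and iso: "\<And>\<Phi>. ucp \<Phi> \<Longrightarrow> os_isometric (C_system X) (B_system (lcosets\<^bsub>G\<^esub> H)) \<Phi>"
      using boundary by simp_all
    from ex obtain \<Phi> where \<Phi>: "ucp \<Phi>" ..
    have "{} \<noteq> Prob_invariant H X \<phi>"
      by (rule ucp_measure[OF \<Phi>]) blast
    moreover have "\<nu> \<in> Prob_contractible G X \<phi>" if "\<nu> \<in> Prob_invariant H X \<phi>" for \<nu>
      using that isometric_contractible[OF that iso[OF poisson_ucp[OF that]]]
      by (simp add: Prob_contractible_def Prob_invariant_def)
    ultimately show "{} \<noteq> Prob_invariant H X \<phi> \<and> Prob_invariant H X \<phi> \<subseteq> Prob_contractible G X \<phi>"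
      by blast
  next
    assume *: "{} \<noteq> Prob_invariant H X \<phi> \<and> Prob_invariant H X \<phi> \<subseteq> Prob_contractible G X \<phi>"
    then obtain \<nu> where "\<nu> \<in> Prob_invariant H X \<phi>" by blast
    then have "ucp (poisson \<nu>)" by (rule poisson_ucp)
    then show "coset_boundary G H X \<phi>"
      unfolding boundary using * by (intro conjI exI allI impI ucp_isometric) auto
  qed
qed

end
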